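(* Let $\mathbb{A}$ be a finite relational structure and let $\mathcal{D}(\mathbb{A})$ be the digraph constructed from $\mathbb{A}$ as in the context. Let $\Sigma$ be a linear idempotent set of identities such that the zigzag satisfies $\Sigma$ (i.e. the algebra of polymorphisms of the zigzag satisfies $\Sigma$) and each identity in $\Sigma$ is either balanced or contains at most two variables. Then $$\mathcal{D}(\mathbb{A})\models\Sigma\quad\text{if and only if}\quad \mathbb{A}\models\Sigma .$$
   Context: A finite relational structure $\mathbb{A}=(A;R_1,\dots,R_n)$ ($n\ge1$) is a finite set $A$ with finitely many nonempty relations $R_i\subseteq A^{k_i}$, $k_i\ge 1$. A digraph is a structure with one binary relation $\to$. Construction of $\mathcal{D}(\mathbb{A})$. Let $k=\sum_i k_i$ and let $R=R_1\times\dots\times R_n\subseteq A^k$ (concatenations of tuples). The single edge is the oriented path $\bullet\to\bullet$ and the zigzag is the oriented path $\bullet\to\bullet\leftarrow\bullet\to\bullet$; an oriented path $\mathbb{P}$ has an initial (first) vertex $\iota\mathbb{P}$ and a terminal (last) vertex $\tau\mathbb{P}$, and the concatenation $\mathbb{P}\dotplus\mathbb{P}'$ is obtained by identifying $\tau\mathbb{P}$ with $\iota\mathbb{P}'$. For $\mathcal{I}\subseteq[k]=\{1,\dots,k\}$ and $l\in[k]$ let $\mathbb{Q}_{\mathcal{I},l}$ be a single edge if $l\in\mathcal{I}$ and a zigzag if $l\notin\mathcal{I}$, and let $\mathbb{Q}_{\mathcal{I}}=(\bullet\to\bullet)\dotplus\mathbb{Q}_{\mathcal{I},1}\dotplus\dots\dotplus\mathbb{Q}_{\mathcal{I},k}\dotplus(\bullet\to\bullet)$.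 For $e=(a,\mathbf{r})\in A\times R$ let $\mathbb{P}_e=\mathbb{Q}_{\{i\,:\,a=r_i\}}$. The digraph $\mathcal{D}(\mathbb{A})$ is obtained from the disjoint union of the vertex sets $A$ and $R$ by adding, for each $e=(a,\mathbf{r})\in A\times R$, a fresh copy of $\mathbb{P}_e$ with $\iota\mathbb{P}_e$ identified with $a$ and $\tau\mathbb{P}_e$ identified with $\mathbf{r}$. A polymorphism of a structure is a finitary operation on its domain that, applied coordinatewise, preserves all its relations. An (operational) signature is a possibly infinite set of operation symbols with finite positive arities; an identity is an expression $u\approx v$ with $u,v$ terms. It is linear if each of $u$ and $v$ contains at most one occurrence of an operation symbol, and balanced if the same set of variables occurs in $u$ and in $v$. A set of identities $\Sigma$ (possibly infinite) is linear if all its identities are linear; it is idempotent if for each operation symbol $f$ appearing in $\Sigma$ the identity $f(x,\dots,x)\approx x$ is in $\Sigma$. A structure $\mathbb{B}$ satisfies $\Sigma$, written $\mathbb{B}\models\Sigma$, if each operation symbol of $\Sigma$ can be interpreted as a polymorphism of $\mathbb{B}$ of the same arity so that all identities of $\Sigma$ hold universally. *)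

theory Defs
  imports Main
begin

section \<open>Finite relational structures and polymorphisms\<close>

text \<open>Tuples are lists. Each relation is listed together with its arity.\<close>

record 'a rel_structure =
  univ :: "'a set"
  rels :: "(nat \<times> 'a list set) list"

definition finite_rel_structure :: "'a rel_structure \<Rightarrow> bool" where
  "finite_rel_structure \<A> \<longleftrightarrow>
     finite (univ \<A>) \<and> rels \<A> \<noteq> [] \<and>
     (\<forall>(k, R) \<in> set (rels \<A>).
        k \<ge> 1 \<and> R \<noteq> {} \<and> R \<subseteq> {t. length t = k \<and> set t \<subseteq> univ \<A>})"

definition digraph :: "'a set \<Rightarrow> ('a \<times> 'a) set \<Rightarrow> 'a rel_structure" where
  "digraph V E = \<lparr>univ = V, rels = [(2, {[u, v] | u v. (u, v) \<in> E})]\<rparr>"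

text \<open>An \<open>n\<close>-ary operation is a function on lists, of which only the values at lists of
  length \<open>n\<close> over the universe matter.\<close>

definition polymorphism :: "'a rel_structure \<Rightarrow> nat \<Rightarrow> ('a list \<Rightarrow> 'a) \<Rightarrow> bool" where
  "polymorphism \<A> n f \<longleftrightarrow>
     (\<forall>xs. length xs = n \<and> set xs \<subseteq> univ \<A> \<longrightarrow> f xs \<in> univ \<A>) \<and>
     (\<forall>(k, R) \<in> set (rels \<A>). \<forall>ts. length ts = n \<and> set ts \<subseteq> R \<longrightarrow>
        map (\<lambda>i. f (map (\<lambda>t. t ! i) ts)) [0..<k] \<in> R)"


section \<open>Terms and identities\<close>

text \<open>A signature is given by an arity function on the type of operation symbols.\<close>

datatype ('f, 'v) trm = Var 'v | App 'f "('f, 'v) trm list"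

type_synonym ('f, 'v) identity = "('f, 'v) trm \<times> ('f, 'v) trm"

fun vars :: "('f, 'v) trm \<Rightarrow> 'v set" where
  "vars (Var x) = {x}"
| "vars (App f ts) = (\<Union>t \<in> set ts. vars t)"

fun symbols :: "('f, 'v) trm \<Rightarrow> 'f set" where
  "symbols (Var x) = {}"
| "symbols (App f ts) = insert f (\<Union>t \<in> set ts. symbols t)"

text \<open>The number of occurrences of operation symbols, counted with multiplicity.\<close>

fun symbol_occs :: "('f, 'v) trm \<Rightarrow> nat" where
  "symbol_occs (Var x) = 0"
| "symbol_occs (App f ts) = 1 + sum_list (map symbol_occs ts)"

fun wf_trm :: "('f \<Rightarrow> nat) \<Rightarrow> ('f, 'v) trm \<Rightarrow> bool" where
  "wf_trm ar (Var x) \<longleftrightarrow> True"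
| "wf_trm ar (App f ts) \<longleftrightarrow> ar f \<ge> 1 \<and> length ts = ar f \<and> (\<forall>t \<in> set ts. wf_trm ar t)"

fun eval_trm :: "('f \<Rightarrow> 'a list \<Rightarrow> 'a) \<Rightarrow> ('v \<Rightarrow> 'a) \<Rightarrow> ('f, 'v) trm \<Rightarrow> 'a" where
  "eval_trm I \<sigma> (Var x) = \<sigma> x"
| "eval_trm I \<sigma> (App f ts) = I f (map (eval_trm I \<sigma>) ts)"

definition wf_identities :: "('f \<Rightarrow> nat) \<Rightarrow> ('f, 'v) identity set \<Rightarrow> bool" where
  "wf_identities ar \<Sigma> \<longleftrightarrow> (\<forall>(u, v) \<in> \<Sigma>. wf_trm ar u \<and> wf_trm ar v)"

definition symbols_of :: "('f, 'v) identity set \<Rightarrow> 'f set" where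
  "symbols_of \<Sigma> = (\<Union>(u, v) \<in> \<Sigma>. symbols u \<union> symbols v)"

definition linear_identity :: "('f, 'v) identity \<Rightarrow> bool" where
  "linear_identity = (\<lambda>(u, v). symbol_occs u \<le> 1 \<and> symbol_occs v \<le> 1)"

definition balanced_identity :: "('f, 'v) identity \<Rightarrow> bool" where
  "balanced_identity = (\<lambda>(u, v). vars u = vars v)"

definition vars_identity :: "('f, 'v) identity \<Rightarrow> 'v set" where
  "vars_identity = (\<lambda>(u, v). vars u \<union> vars v)"

definition linear_identities :: "('f, 'v) identity set \<Rightarrow> bool" where
  "linear_identities \<Sigma> \<longleftrightarrow> (\<forall>p \<in> \<Sigma>. linear_identity p)"

definition idempotent_identities :: "('f \<Rightarrow> nat) \<Rightarrow> ('f, 'v) identity set \<Rightarrow> bool" where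
  "idempotent_identities ar \<Sigma> \<longleftrightarrow>
     (\<forall>f \<in> symbols_of \<Sigma>. \<exists>x. (App f (replicate (ar f) (Var x)), Var x) \<in> \<Sigma>)"

definition satisfies :: "('f \<Rightarrow> nat) \<Rightarrow> 'a rel_structure \<Rightarrow> ('f, 'v) identity set \<Rightarrow> bool" where
  "satisfies ar \<B> \<Sigma> \<longleftrightarrow>
     (\<exists>I. (\<forall>f \<in> symbols_of \<Sigma>. polymorphism \<B> (ar f) (I f)) \<and>
          (\<forall>(u, v) \<in> \<Sigma>. \<forall>\<sigma>. range \<sigma> \<subseteq> univ \<B> \<longrightarrow> eval_trm I \<sigma> u = eval_trm I \<sigma> v))"


section \<open>Oriented paths\<close>

text \<open>An oriented path is the list of its edge directions, \<open>True\<close> meaning forward. The path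
  \<open>p\<close> has vertices \<open>0, \<dots>, length p\<close>, with initial vertex \<open>0\<close> and terminal vertex
  \<open>length p\<close>, and concatenation of paths is concatenation of lists.\<close>

type_synonym opath = "bool list"

definition path_edges :: "opath \<Rightarrow> (nat \<times> nat) set" where
  "path_edges p = {(i, Suc i) | i. i < length p \<and> p ! i} \<union>
                  {(Suc i, i) | i. i < length p \<and> \<not> p ! i}"

definition path_digraph :: "opath \<Rightarrow> nat rel_structure" where
  "path_digraph p = digraph {0..length p} (path_edges p)"

definition single_edge :: opath where
  "single_edge = [True]"

definition zigzag :: opath where
  "zigzag = [True, False, True]"

definition Q_seg :: "nat set \<Rightarrow> nat \<Rightarrow> opath" where
  "Q_seg I l = (if l \<in> I then single_edge else zigzag)"

definition Q_path :: "nat \<Rightarrow> nat set \<Rightarrow> opath" where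
  "Q_path k I = single_edge @ concat (map (Q_seg I) [1..<Suc k]) @ single_edge"


section \<open>The digraph of a structure\<close>

definition total_arity :: "'a rel_structure \<Rightarrow> nat" where
  "total_arity \<A> = sum_list (map fst (rels \<A>))"

text \<open>The product of the relations, as a set of concatenated tuples.\<close>

definition total_rel :: "'a rel_structure \<Rightarrow> 'a list set" where
  "total_rel \<A> = concat ` listset (map snd (rels \<A>))"

text \<open>Coordinates are numbered from 1, list positions from 0.\<close>

definition P_path :: "'a rel_structure \<Rightarrow> 'a \<Rightarrow> 'a list \<Rightarrow> opath" where
  "P_path \<A> a r =
     Q_path (total_arity \<A>) {i \<in> {1..total_arity \<A>}. a = r ! (i - 1)}"

text \<open>\<open>Inner a r i\<close> is the \<open>i\<close>-th vertex of the copy of the path for \<open>(a, r)\<close>,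
  where \<open>i\<close> is neither the initial nor the terminal position.\<close>

datatype 'a dvertex = Elem 'a | Tup "'a list" | Inner 'a "'a list" nat

definition path_vertex :: "'a rel_structure \<Rightarrow> 'a \<Rightarrow> 'a list \<Rightarrow> nat \<Rightarrow> 'a dvertex" where
  "path_vertex \<A> a r i =
     (if i = 0 then Elem a
      else if i = length (P_path \<A> a r) then Tup r
      else Inner a r i)"

definition D_vertices :: "'a rel_structure \<Rightarrow> 'a dvertex set" where
  "D_vertices \<A> = Elem ` univ \<A> \<union> Tup ` total_rel \<A> \<union>
     {path_vertex \<A> a r i | a r i.
        a \<in> univ \<A> \<and> r \<in> total_rel \<A> \<and> i \<le> length (P_path \<A> a r)}"

definition D_edges :: "'a rel_structure \<Rightarrow> ('a dvertex \<times> 'a dvertex) set" where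
  "D_edges \<A> =
     {(path_vertex \<A> a r i, path_vertex \<A> a r j) | a r i j.
        a \<in> univ \<A> \<and> r \<in> total_rel \<A> \<and> (i, j) \<in> path_edges (P_path \<A> a r)}"

definition D_digraph :: "'a rel_structure \<Rightarrow> 'a dvertex rel_structure" where
  "D_digraph \<A> = digraph (D_vertices \<A>) (D_edges \<A>)"

end

theory Submission
  imports Defs "HOL-Library.Product_Lexorder"
begin

text \<open>
  Each path of \<open>\<D>(\<A>)\<close> climbs the same number of levels, with the elements at the
  bottom and the tuples at the top. A polymorphism of \<open>\<D>(\<A>)\<close> therefore maps elements to
  elements and tuples to tuples. That \<open>a\<close> is the \<open>l\<close>-th entry of \<open>r\<close> means that the oriented
  path with a single edge as its \<open>l\<close>-th segment and zigzags elsewhere leads from \<open>a\<close> to \<open>r\<close>,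
  and this is preserved.

  Conversely, let polymorphisms of \<open>\<A>\<close> and of the zigzag be given. Arguments on a common level
  are mapped into the path between the images of their elements and tuples; within a zigzag
  segment the polymorphism of the zigzag is applied if all arguments lie in zigzags, and the
  first of the arguments lying in zigzags is taken otherwise. All remaining tuples of arguments
  that are on an edge have at least two levels. If there are exactly two, the polymorphism of the
  zigzag, applied to its two sources, selects one of the levels, and the least argument of that
  level is taken; if there are more, the least argument of the lowest level is taken. The outcome
  depends only on the set of arguments wherever neither of the given operations is consulted,
  which yields the balanced identities; an identity in two variables that is not balanced
  reduces to an absorption law \<open>f(x, \<dots>, y, \<dots>) \<approx> y\<close>.
\<close>


section \<open>Linear terms\<close>

text \<open>An absorption law prescribes its value wherever the absorbed argument lies, so no rule
  that looks only at the set of arguments can serve for two distinct vertices. The choice is left to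
  \<open>g\<close> and \<open>h\<close>, which already satisfy the identities: two vertices either
  share a segment or fall into two groups. As soon as three levels occur, at least three variables
  do, so only a balanced identity can be at stake and a rule depending on the set is enough.

  A second obstacle is that an element belongs to no particular tuple and a tuple to no particular
  element, so half of the data of a path is missing at either end. The single edges at both ends of
  each path keep the zigzags away from these places, and separate orders are used near the bottom
  and near the top.

  Linearity makes each side of an identity one operation applied to variables, so operations can be
  lifted one by one. Idempotence makes a vertex between two segments receive the same image from
  both, and collapses a side with a single variable to that variable.\<close>

fun term_args :: "('f, 'v) trm \<Rightarrow> 'v list" where
  "term_args (Var x) = [x]"
| "term_args (App f ts) = map (\<lambda>t. the_elem (vars t)) ts"

text \<open>A variable counts as the projection \<open>hd\<close> applied to a one-element list, so
  both sides of a linear identity have the same form: one operation applied to a list of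
  variables.\<close>

fun term_op :: "('f \<Rightarrow> 'a list \<Rightarrow> 'a) \<Rightarrow> ('f, 'v) trm \<Rightarrow> 'a list \<Rightarrow> 'a" where
  "term_op I (Var x) = hd"
| "term_op I (App f ts) = I f"

lemma symbol_free_trm:
  assumes "symbol_occs t = 0"
  shows "t = Var (the_elem (vars t))"
  using assms by (cases t) auto

lemma linear_App_args:
  assumes "symbol_occs (App f ts) \<le> 1" "t \<in> set ts"
  shows "t = Var (the_elem (vars t))"
proof -
  have "\<forall>n \<in> set (map symbol_occs ts). n = 0"
    using assms(1) by (simp add: sum_list_eq_0_iff)
  then show ?thesis using assms(2) symbol_free_trm by auto
qed

lemma eval_trm_linear:
  assumes "symbol_occs t \<le> 1"
  shows "eval_trm I \<sigma> t = term_op I t (map \<sigma> (term_args t))"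
proof (cases t)
  case (App f ts)
  have "map (eval_trm I \<sigma>) ts = map \<sigma> (term_args t)"
    unfolding App term_args.simps map_map
  proof (rule map_cong[OF refl])
    fix s assume "s \<in> set ts"
    then have "s = Var (the_elem (vars s))" using assms linear_App_args[of f ts s] unfolding App by blast
    then have "eval_trm I \<sigma> s = eval_trm I \<sigma> (Var (the_elem (vars s)))" by (rule arg_cong)
    then show "eval_trm I \<sigma> s = (\<sigma> \<circ> (\<lambda>t. the_elem (vars t))) s" by simp
  qed
  moreover have "eval_trm I \<sigma> t = I f (map (eval_trm I \<sigma>) ts)" using App by simp
  ultimately show ?thesis using App by (simp only: term_op.simps)
qed simp

lemma set_term_args:
  assumes "symbol_occs t \<le> 1"
  shows "set (term_args t) = vars t"
proof (cases t)
  case (App f ts)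
  have "vars s = {the_elem (vars s)}" if "s \<in> set ts" for s
    using arg_cong[where f = vars, OF linear_App_args[of f ts s]] assms App that by simp
  then show ?thesis using App by auto
qed simp

lemma term_args_nonempty: "wf_trm ar t \<Longrightarrow> term_args t \<noteq> []"
  by (cases t) auto

definition term_arity :: "('f \<Rightarrow> nat) \<Rightarrow> ('f, 'v) trm \<Rightarrow> nat" where
  "term_arity ar t = (case t of Var x \<Rightarrow> 1 | App f ts \<Rightarrow> ar f)"

lemma length_term_args: "wf_trm ar t \<Longrightarrow> length (term_args t) = term_arity ar t"
  by (cases t) (auto simp: term_arity_def)

lemma symbols_of_arity:
  assumes "wf_identities ar \<Sigma>" "f \<in> symbols_of \<Sigma>"
  shows "ar f \<ge> 1"
proof -
  have "wf_trm ar t \<Longrightarrow> f \<in> symbols t \<Longrightarrow> ar f \<ge> 1" for t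
    by (induction t) auto
  then show ?thesis using assms by (fastforce simp: wf_identities_def symbols_of_def)
qed


section \<open>Polymorphisms of digraphs\<close>

lemma polymorphism_digraph_iff:
  "polymorphism (digraph V E) n f \<longleftrightarrow>
     (\<forall>xs. length xs = n \<and> set xs \<subseteq> V \<longrightarrow> f xs \<in> V) \<and>
     (\<forall>us vs. length us = n \<and> list_all2 (\<lambda>u v. (u, v) \<in> E) us vs \<longrightarrow> (f us, f vs) \<in> E)"
    (is "_ \<longleftrightarrow> ?V \<and> ?E")
proof -
  let ?R = "{[u, v] | u v. (u, v) \<in> E}"
  have "(\<forall>ts. length ts = n \<and> set ts \<subseteq> ?R \<longrightarrow> map (\<lambda>i. f (map (\<lambda>t. t ! i) ts)) [0..<2] \<in> ?R)
      \<longleftrightarrow> ?E" (is "?T \<longleftrightarrow> _")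
  proof
    assume T: ?T
    show ?E
    proof (intro allI impI, elim conjE)
      fix us vs assume *: "length us = n" "list_all2 (\<lambda>u v. (u, v) \<in> E) us vs"
      let ?ts = "map2 (\<lambda>u v. [u, v]) us vs"
      have len: "length us = length vs" using * list_all2_lengthD by blast
      have "set ?ts \<subseteq> ?R" using *(2) by (fastforce simp: list_all2_iff)
      moreover have "length ?ts = n" using * len by simp
      ultimately have "map (\<lambda>i. f (map (\<lambda>t. t ! i) ?ts)) [0..<2] \<in> ?R"
        using T by blast
      moreover have "map (\<lambda>t. t ! 0) ?ts = us" "map (\<lambda>t. t ! Suc 0) ?ts = vs"
        using len by (auto intro!: nth_equalityI)
      ultimately show "(f us, f vs) \<in> E" by (simp add: upt_rec numeral_2_eq_2)
    qed
  next
    assume E: ?E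
    show ?T
    proof (intro allI impI, elim conjE)
      fix ts assume *: "length ts = n" "set ts \<subseteq> ?R"
      have "list_all2 (\<lambda>u v. (u, v) \<in> E) (map (\<lambda>t. t ! 0) ts) (map (\<lambda>t. t ! Suc 0) ts)"
        using *(2) by (fastforce simp: list_all2_conv_all_nth dest: nth_mem)
      then have "(f (map (\<lambda>t. t ! 0) ts), f (map (\<lambda>t. t ! Suc 0) ts)) \<in> E"
        using E *(1) by simp
      then show "map (\<lambda>i. f (map (\<lambda>t. t ! i) ts)) [0..<2] \<in> ?R"
        by (simp add: upt_rec numeral_2_eq_2)
    qed
  qed
  then show ?thesis by (simp add: polymorphism_def digraph_def)
qed

text \<open>Each operation is conjugated: \<alpha> on the arguments, \<beta> on the value. Nested
  symbols would pick up \<alpha> after \<beta> in between; a linear term has no nesting, and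
  \<open>inv\<close> takes care of a bare variable. Used in both directions, this carries
  satisfaction across an isomorphism.\<close>

lemma satisfies_digraph_retract:
  assumes lin: "linear_identities \<Sigma>"
    and wf: "wf_identities ar \<Sigma>"
    and \<alpha>: "\<And>x. x \<in> V \<Longrightarrow> \<alpha> x \<in> V'" "\<And>x y. (x, y) \<in> E \<Longrightarrow> (\<alpha> x, \<alpha> y) \<in> E'"
    and \<beta>: "\<And>x. x \<in> V' \<Longrightarrow> \<beta> x \<in> V" "\<And>x y. (x, y) \<in> E' \<Longrightarrow> (\<beta> x, \<beta> y) \<in> E"
    and inv: "\<And>x. x \<in> V \<Longrightarrow> \<beta> (\<alpha> x) = x"
    and sat: "satisfies ar (digraph V' E') \<Sigma>"
  shows "satisfies ar (digraph V E) \<Sigma>"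
proof -
  obtain I where I: "\<And>f. f \<in> symbols_of \<Sigma> \<Longrightarrow> polymorphism (digraph V' E') (ar f) (I f)"
    "\<And>u v \<sigma>. (u, v) \<in> \<Sigma> \<Longrightarrow> range \<sigma> \<subseteq> V' \<Longrightarrow> eval_trm I \<sigma> u = eval_trm I \<sigma> v"
    using sat by (fastforce simp: satisfies_def digraph_def)
  define J where "J f xs = \<beta> (I f (map \<alpha> xs))" for f xs
  have "polymorphism (digraph V E) (ar f) (J f)" if "f \<in> symbols_of \<Sigma>" for f
  proof -
    have "list_all2 (\<lambda>u v. (u, v) \<in> E') (map \<alpha> us) (map \<alpha> vs)"
      if "list_all2 (\<lambda>u v. (u, v) \<in> E) us vs" for us vs
      using that \<alpha>(2) by (auto simp: list_all2_conv_all_nth)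
    moreover have "set (map \<alpha> xs) \<subseteq> V'" if "set xs \<subseteq> V" for xs using that \<alpha>(1) by auto
    ultimately show ?thesis
      using I(1)[OF that] \<beta> by (simp add: polymorphism_digraph_iff J_def)
  qed
  moreover have "eval_trm J \<sigma> u = eval_trm J \<sigma> v"
    if uv: "(u, v) \<in> \<Sigma>" and \<sigma>: "range \<sigma> \<subseteq> V" for u v \<sigma>
  proof -
    have J: "eval_trm J \<sigma> t = \<beta> (eval_trm I (\<alpha> \<circ> \<sigma>) t)" if t: "symbol_occs t \<le> 1" for t
    proof (cases t)
      case (Var x)
      moreover have "\<sigma> x \<in> V" using \<sigma> by blast
      ultimately show ?thesis using inv by simp
    next
      case (App f ts)
      then show ?thesis using eval_trm_linear[OF t, of J \<sigma>] eval_trm_linear[OF t, of I "\<alpha> \<circ> \<sigma>"]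
        by (simp add: J_def comp_assoc del: eval_trm.simps)
    qed
    have "symbol_occs u \<le> 1" "symbol_occs v \<le> 1"
      using lin uv by (auto simp: linear_identities_def linear_identity_def)
    moreover have "eval_trm I (\<alpha> \<circ> \<sigma>) u = eval_trm I (\<alpha> \<circ> \<sigma>) v"
      using I(2)[OF uv] \<sigma> \<alpha>(1) by (auto simp: image_subset_iff)
    ultimately show ?thesis using J by simp
  qed
  ultimately show ?thesis unfolding satisfies_def
    by (intro exI[of _ J]) (auto simp: digraph_def)
qed


section \<open>Products of relations\<close>

definition product_rel :: "(nat \<times> 'a list set) list \<Rightarrow> 'a list set" where
  "product_rel rs = concat ` listset (map snd rs)"

lemma product_rel_Nil [simp]: "product_rel [] = {[]}"
  by (simp add: product_rel_def)

lemma product_rel_Cons [simp]: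
  "product_rel ((k, R) # rs) = {t @ r | t r. t \<in> R \<and> r \<in> product_rel rs}"
proof -
  have "product_rel ((k, R) # rs) = concat ` {t # ts | t ts. t \<in> R \<and> ts \<in> listset (map snd rs)}"
    by (simp add: product_rel_def set_Cons_def)
  also have "\<dots> = {t @ r | t r. t \<in> R \<and> r \<in> concat ` listset (map snd rs)}"
  proof (intro equalityI subsetI)
    fix x assume "x \<in> {t @ r | t r. t \<in> R \<and> r \<in> concat ` listset (map snd rs)}"
    then obtain t ts where "x = concat (t # ts)" "t \<in> R" "ts \<in> listset (map snd rs)" by auto
    then show "x \<in> concat ` {t # ts | t ts. t \<in> R \<and> ts \<in> listset (map snd rs)}" by blast
  qed fastforce
  finally show ?thesis by (simp add: product_rel_def)
qed

lemma length_product_rel: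
  assumes "\<forall>(k, R) \<in> set rs. \<forall>t \<in> R. length t = k" "r \<in> product_rel rs"
  shows "length r = sum_list (map fst rs)"
  using assms
proof (induction rs arbitrary: r)
  case (Cons p rs)
  obtain k R where p: "p = (k, R)" by (cases p)
  obtain t r' where r: "r = t @ r'" "t \<in> R" "r' \<in> product_rel rs"
    using Cons.prems(2) unfolding p product_rel_Cons by blast
  have "length t = k" using Cons.prems(1) r(2) p by simp
  moreover have "length r' = sum_list (map fst rs)" using Cons.IH[of r'] Cons.prems(1) r(3) by simp
  ultimately show ?case using r(1) p by simp
qed simp

lemma finite_product_rel:
  assumes "\<forall>(k, R) \<in> set rs. finite R"
  shows "finite (product_rel rs)"
  using assms
proof (induction rs)
  case (Cons p rs)
  obtain k R where p: "p = (k, R)" by (cases p)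
  have "product_rel (p # rs) = (\<lambda>(t, r). t @ r) ` (R \<times> product_rel rs)"
    unfolding p by auto
  then show ?case using Cons p by simp
qed simp

lemma product_rel_nonempty:
  assumes "\<forall>(k, R) \<in> set rs. R \<noteq> {}"
  shows "product_rel rs \<noteq> {}"
  using assms by (induction rs) fastforce+

lemma product_rel_coordinatewise:
  assumes "\<forall>(k, R) \<in> set rs. (\<forall>t \<in> R. length t = k) \<and>
      (\<forall>ts. length ts = n \<and> set ts \<subseteq> R \<longrightarrow> map (\<lambda>i. f (map (\<lambda>t. t ! i) ts)) [0..<k] \<in> R)"
    and "length ts = n" "set ts \<subseteq> product_rel rs"
  shows "map (\<lambda>i. f (map (\<lambda>t. t ! i) ts)) [0..<sum_list (map fst rs)] \<in> product_rel rs"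
  using assms
proof (induction rs arbitrary: ts)
  case (Cons p rs)
  obtain k R where p: "p = (k, R)" by (cases p)
  let ?m = "sum_list (map fst rs)"
  let ?F = "\<lambda>ts i. f (map (\<lambda>t. t ! i) ts)"
  have k: "\<And>t. t \<in> R \<Longrightarrow> length t = k" using Cons.prems(1) p by auto
  have ts: "take k t \<in> R \<and> drop k t \<in> product_rel rs \<and> k \<le> length t" if t: "t \<in> set ts" for t
  proof -
    obtain t1 t2 where "t = t1 @ t2" "t1 \<in> R" "t2 \<in> product_rel rs"
      using subsetD[OF Cons.prems(3) t] unfolding p product_rel_Cons by blast
    then show ?thesis using k[of t1] by simp
  qed
  have "map (?F (map (take k) ts)) [0..<k] \<in> R"
  proof -
    have "\<forall>ts. length ts = n \<and> set ts \<subseteq> R \<longrightarrow> map (?F ts) [0..<k] \<in> R"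
      using Cons.prems(1) unfolding p list.set ball_simps prod.case by blast
    moreover have "length (map (take k) ts) = n" "set (map (take k) ts) \<subseteq> R"
      using Cons.prems(2) ts by auto
    ultimately show ?thesis by blast
  qed
  moreover have "map (?F (map (drop k) ts)) [0..<?m] \<in> product_rel rs"
    using Cons.prems ts p by (intro Cons.IH) auto
  moreover have "map (?F ts) [0..<k + ?m] =
      map (?F (map (take k) ts)) [0..<k] @ map (?F (map (drop k) ts)) [0..<?m]"
  proof -
    have "map (?F ts) [0..<k + ?m] = map (?F ts) [0..<k] @ map (\<lambda>i. ?F ts (k + i)) [0..<?m]"
      by (rule nth_equalityI) (auto simp: nth_append)
    moreover have "map (?F ts) [0..<k] = map (?F (map (take k) ts)) [0..<k]"
      by (auto simp: comp_def)
    moreover have "map (\<lambda>t. t ! (k + i)) ts = map (\<lambda>t. t ! i) (map (drop k) ts)" for i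
      using ts by simp
    ultimately show ?thesis by simp
  qed
  ultimately show ?case unfolding p by auto
qed simp

text \<open>\<open>p\<close> is the total arity of the relations listed before \<open>R\<close>. A
  tuple of \<open>R\<close> is completed to a tuple of the product because the other relations are
  nonempty.\<close>

lemma product_rel_block:
  assumes "\<forall>(k, R) \<in> set rs. R \<noteq> {} \<and> (\<forall>t \<in> R. length t = k)" "(k, R) \<in> set rs"
  shows "\<exists>p. p + k \<le> sum_list (map fst rs) \<and>
      (\<forall>t \<in> R. \<exists>r \<in> product_rel rs. \<forall>i < k. r ! (p + i) = t ! i) \<and>
      (\<forall>r \<in> product_rel rs. map (\<lambda>i. r ! (p + i)) [0..<k] \<in> R)"
  using assms
proof (induction rs)
  case (Cons q rs)
  obtain k' R' where q: "q = (k', R')" by (cases q)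
  have len: "\<And>t. t \<in> R' \<Longrightarrow> length t = k'" using Cons.prems q by auto
  show ?case
  proof (cases "(k, R) = q")
    case True
    obtain r0 where r0: "r0 \<in> product_rel rs"
      using product_rel_nonempty[of rs] Cons.prems(1) by fastforce
    have "\<exists>r \<in> product_rel (q # rs). \<forall>i < k. r ! (0 + i) = t ! i" if "t \<in> R" for t
    proof
      show "t @ r0 \<in> product_rel (q # rs)" using that r0 True q by auto
      show "\<forall>i < k. (t @ r0) ! (0 + i) = t ! i" using that len True q by (auto simp: nth_append)
    qed
    moreover have "map (\<lambda>i. r ! (0 + i)) [0..<k] \<in> R" if r: "r \<in> product_rel (q # rs)" for r
    proof -
      obtain t r' where t: "t \<in> R" "r = t @ r'" using r True q by auto
      then have "map (\<lambda>i. r ! (0 + i)) [0..<k] = t"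
        using len True q by (intro nth_equalityI) (auto simp: nth_append)
      then show ?thesis using t by simp
    qed
    ultimately show ?thesis using True q by (intro exI[of _ 0]) auto
  next
    case False
    obtain p where p: "p + k \<le> sum_list (map fst rs)"
      "\<And>t. t \<in> R \<Longrightarrow> \<exists>r \<in> product_rel rs. \<forall>i < k. r ! (p + i) = t ! i"
      "\<And>r. r \<in> product_rel rs \<Longrightarrow> map (\<lambda>i. r ! (p + i)) [0..<k] \<in> R"
    proof -
      have "(k, R) \<in> set rs" using Cons.prems(2) False by auto
      then have "\<exists>p. p + k \<le> sum_list (map fst rs) \<and>
          (\<forall>t \<in> R. \<exists>r \<in> product_rel rs. \<forall>i < k. r ! (p + i) = t ! i) \<and>
          (\<forall>r \<in> product_rel rs. map (\<lambda>i. r ! (p + i)) [0..<k] \<in> R)"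
        using Cons.IH Cons.prems(1) by simp
      then show thesis using that by blast
    qed
    obtain t0 where t0: "t0 \<in> R'" using Cons.prems q by auto
    have "\<exists>r \<in> product_rel (q # rs). \<forall>i < k. r ! (k' + p + i) = t ! i" if t: "t \<in> R" for t
    proof -
      obtain r where "r \<in> product_rel rs" "\<forall>i < k. r ! (p + i) = t ! i" using p(2)[OF t] by blast
      then show ?thesis using t0 len[OF t0] q
        by (intro bexI[of _ "t0 @ r"]) (auto simp: nth_append)
    qed
    moreover have "map (\<lambda>i. r ! (k' + p + i)) [0..<k] \<in> R" if r: "r \<in> product_rel (q # rs)" for r
    proof -
      obtain t r' where "t \<in> R'" "r' \<in> product_rel rs" "r = t @ r'"
        using r unfolding q product_rel_Cons by blast
      then show ?thesis using p(3)[of r'] len by (simp add: nth_append add.assoc)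
    qed
    ultimately show ?thesis using p(1) q by (intro exI[of _ "k' + p"]) auto
  qed
qed simp


section \<open>Paths made of single edges and zigzags\<close>

definition zz_path :: "(nat \<Rightarrow> bool) \<Rightarrow> nat \<Rightarrow> opath" where
  "zz_path z n = concat (map (\<lambda>s. if z s then zigzag else single_edge) [0..<n])"

text \<open>The vertex at offset \<open>i\<close> of segment \<open>s\<close> gets the code \<open>3 * s + i\<close>, whether the segments
  before it are edges or zigzags; the codes still increase along the path.\<close>

definition zz_codes :: "(nat \<Rightarrow> bool) \<Rightarrow> nat \<Rightarrow> nat set" where
  "zz_codes z n = {m. m \<le> 3 * n \<and> (m mod 3 = 0 \<or> z (m div 3))}"

definition zz_pos :: "(nat \<Rightarrow> bool) \<Rightarrow> nat \<Rightarrow> nat" where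
  "zz_pos z m = length (zz_path z (m div 3)) + m mod 3"

definition zz_edges :: "(nat \<Rightarrow> bool) \<Rightarrow> nat \<Rightarrow> (nat \<times> nat) set" where
  "zz_edges z n = (\<Union>s < n. if z s then {(3 * s, 3 * s + 1), (3 * s + 2, 3 * s + 1), (3 * s + 2, 3 * s + 3)}
                          else {(3 * s, 3 * s + 3)})"

lemma code_div_mod [simp]:
  "Suc (3 * s) div 3 = s" "Suc (Suc (3 * s)) div 3 = s" "(3 * s + 3) div 3 = Suc s"
  "Suc (3 * s) mod 3 = 1" "Suc (Suc (3 * s)) mod 3 = 2" "(3 * s + 3) mod 3 = 0"
  by presburger+

lemma path_edges_append:
  "path_edges (p @ q) = path_edges p \<union> map_prod ((+) (length p)) ((+) (length p)) ` path_edges q"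
proof -
  have "{i. i < length (p @ q) \<and> P ((p @ q) ! i)} =
      {i. i < length p \<and> P (p ! i)} \<union> (+) (length p) ` {i. i < length q \<and> P (q ! i)}" for P
  proof (intro equalityI subsetI)
    fix i assume i: "i \<in> {i. i < length (p @ q) \<and> P ((p @ q) ! i)}"
    show "i \<in> {i. i < length p \<and> P (p ! i)} \<union> (+) (length p) ` {i. i < length q \<and> P (q ! i)}"
    proof (cases "i < length p")
      case True
      then show ?thesis using i by (simp add: nth_append)
    next
      case False
      then have "i = length p + (i - length p)" by simp
      moreover have "i - length p < length q \<and> P (q ! (i - length p))"
        using i False by (auto simp: nth_append)
      ultimately show ?thesis by blast
    qed
  qed (auto simp: nth_append)
  note dec = this
  have "path_edges p = (\<lambda>i. (i, Suc i)) ` {i. i < length p \<and> p ! i} \<union>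
      (\<lambda>i. (Suc i, i)) ` {i. i < length p \<and> \<not> p ! i}" for p
    unfolding path_edges_def by blast
  then show ?thesis
    using dec[of "\<lambda>x. x"] dec[of Not] by (simp add: image_Un image_image Un_ac)
qed

lemma path_edges_single_edge: "path_edges single_edge = {(0, 1)}"
  by (auto simp: path_edges_def single_edge_def)

lemma path_edges_zigzag: "path_edges zigzag = {(0, 1), (2, 1), (2, 3)}"
proof -
  have "{i. i < length zigzag \<and> zigzag ! i} = {0, 2}"
    "{i. i < length zigzag \<and> \<not> zigzag ! i} = {1}"
    by (auto simp: zigzag_def less_Suc_eq)
  moreover have "path_edges zigzag = (\<lambda>i. (i, Suc i)) ` {i. i < length zigzag \<and> zigzag ! i} \<union>
      (\<lambda>i. (Suc i, i)) ` {i. i < length zigzag \<and> \<not> zigzag ! i}"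
    unfolding path_edges_def by blast
  ultimately have "path_edges zigzag = (\<lambda>i. (i, Suc i)) ` {0, 2} \<union> (\<lambda>i. (Suc i, i)) ` {1}"
    by (simp only:)
  also have "\<dots> = {(0, 1), (2, 3)} \<union> {(2, 1)}" by (simp add: eval_nat_numeral)
  finally show ?thesis by (simp only: insert_commute Un_insert_left Un_empty_left)
qed

lemma zz_path_Suc: "zz_path z (Suc n) = zz_path z n @ (if z n then zigzag else single_edge)"
  by (simp add: zz_path_def)

lemma zz_pos_offset: "i < 3 \<Longrightarrow> zz_pos z (3 * s + i) = length (zz_path z s) + i"
  by (simp add: zz_pos_def)

lemma zz_pos_3: "zz_pos z (3 * s) = length (zz_path z s)"
  by (simp add: zz_pos_def)

lemma zz_codes_Suc:
  "zz_codes z (Suc n) = zz_codes z n \<union>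
     (if z n then {3 * n + 1, 3 * n + 2, 3 * Suc n} else {3 * Suc n})"
proof -
  have "m \<le> 3 * Suc n \<longleftrightarrow> m \<le> 3 * n \<or> m = 3 * n + 1 \<or> m = 3 * n + 2 \<or> m = 3 * Suc n" for m
    by auto
  then show ?thesis by (auto simp: zz_codes_def)
qed

lemma bij_zz_pos: "bij_betw (zz_pos z) (zz_codes z n) {0..length (zz_path z n)}"
proof (induction n)
  case 0
  have "zz_codes z 0 = {0}" by (auto simp: zz_codes_def)
  then show ?case by (simp add: zz_path_def zz_pos_def bij_betw_def)
next
  case (Suc n)
  let ?l = "length (zz_path z n)"
  let ?C = "if z n then {3 * n + 1, 3 * n + 2, 3 * Suc n} else {3 * Suc n}"
  let ?D = "if z n then {?l + 1, ?l + 2, ?l + 3} else {?l + 1}"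
  have pos: "zz_pos z (3 * n + 1) = ?l + 1" "zz_pos z (3 * n + 2) = ?l + 2"
    "zz_pos z (3 * Suc n) = ?l + (if z n then 3 else 1)"
    using zz_pos_offset[of 1 z n] zz_pos_offset[of 2 z n]
    unfolding zz_pos_3 by (simp_all add: zz_path_Suc zigzag_def single_edge_def)
  have "bij_betw (zz_pos z) ?C ?D"
    using pos by (auto simp: bij_betw_def inj_on_def)
  moreover have "{0..?l} \<inter> ?D = {}" by auto
  ultimately have "bij_betw (zz_pos z) (zz_codes z n \<union> ?C) ({0..?l} \<union> ?D)"
    using Suc bij_betw_combine by blast
  moreover have "{0..?l} \<union> ?D = {0..length (zz_path z (Suc n))}"
    by (auto simp: zz_path_Suc zigzag_def single_edge_def)
  ultimately show ?case by (simp add: zz_codes_Suc)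
qed

lemma path_edges_zz_path:
  "path_edges (zz_path z n) = map_prod (zz_pos z) (zz_pos z) ` zz_edges z n"
proof (induction n)
  case 0
  show ?case by (auto simp: zz_path_def zz_edges_def path_edges_def)
next
  case (Suc n)
  let ?l = "length (zz_path z n)"
  let ?E = "if z n then {(3 * n, 3 * n + 1), (3 * n + 2, 3 * n + 1), (3 * n + 2, 3 * n + 3)}
                          else {(3 * n, 3 * n + 3)}"
  have "zz_pos z (3 * Suc n) = ?l + (if z n then 3 else 1)"
    unfolding zz_pos_3 by (simp add: zz_path_Suc zigzag_def single_edge_def)
  then have pos: "zz_pos z (3 * n) = ?l" "zz_pos z (3 * n + 1) = ?l + 1" "zz_pos z (3 * n + 2) = ?l + 2"
    "zz_pos z (3 * n + 3) = ?l + (if z n then 3 else 1)"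
    using zz_pos_offset[of 1 z n] zz_pos_offset[of 2 z n] by (simp_all add: zz_pos_3 add.commute)
  have "zz_edges z (Suc n) = zz_edges z n \<union> ?E"
    by (auto simp: zz_edges_def lessThan_Suc)
  moreover have "map_prod (zz_pos z) (zz_pos z) ` ?E =
      map_prod ((+) ?l) ((+) ?l) ` path_edges (if z n then zigzag else single_edge)"
    using pos by (simp add: path_edges_zigzag path_edges_single_edge)
  ultimately show ?case by (simp add: zz_path_Suc path_edges_append Suc image_Un)
qed

lemma zz_edges_codes:
  assumes "(i, j) \<in> zz_edges z n"
  shows "i \<in> zz_codes z n" "j \<in> zz_codes z n"
proof -
  obtain s where "s < n" "(i, j) \<in> (if z s then {(3 * s, 3 * s + 1), (3 * s + 2, 3 * s + 1), (3 * s + 2, 3 * s + 3)}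
                          else {(3 * s, 3 * s + 3)})"
    using assms unfolding zz_edges_def by blast
  moreover have "3 * s + 3 = 3 * Suc s" by simp
  ultimately show "i \<in> zz_codes z n" "j \<in> zz_codes z n"
    by (auto simp: zz_codes_def split: if_splits)
qed


section \<open>The digraph of a structure in coded form\<close>

text \<open>Segment \<open>s\<close> belongs to coordinate \<open>s\<close>, which sits at list
  position \<open>s - 1\<close>. Segments \<open>0\<close> and \<open>k + 1\<close> are the edges at
  the two ends and never zigzags.\<close>

definition zz_at :: "nat \<Rightarrow> 'a \<Rightarrow> 'a list \<Rightarrow> nat \<Rightarrow> bool" where
  "zz_at k a r s \<longleftrightarrow> 1 \<le> s \<and> s \<le> k \<and> a \<noteq> r ! (s - 1)"

definition code_vertex :: "nat \<Rightarrow> 'a \<Rightarrow> 'a list \<Rightarrow> nat \<Rightarrow> 'a dvertex" where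
  "code_vertex k a r n = (if n = 0 then Elem a else if n = 3 * (k + 2) then Tup r else Inner a r n)"

definition code_vertices :: "'a set \<Rightarrow> 'a list set \<Rightarrow> nat \<Rightarrow> 'a dvertex set" where
  "code_vertices A R k = Elem ` A \<union> Tup ` R \<union>
     {code_vertex k a r n | a r n. a \<in> A \<and> r \<in> R \<and> n \<in> zz_codes (zz_at k a r) (k + 2)}"

definition code_edges :: "'a set \<Rightarrow> 'a list set \<Rightarrow> nat \<Rightarrow> ('a dvertex \<times> 'a dvertex) set" where
  "code_edges A R k = {(code_vertex k a r m, code_vertex k a r n) | a r m n.
     a \<in> A \<and> r \<in> R \<and> (m, n) \<in> zz_edges (zz_at k a r) (k + 2)}"

lemma P_path_zz_path: "P_path \<A> a r = zz_path (zz_at (total_arity \<A>) a r) (total_arity \<A> + 2)"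
proof -
  define k where "k = total_arity \<A>"
  let ?I = "{i \<in> {1..k}. a = r ! (i - 1)}"
  have "[0..<k + 2] = 0 # [1..<Suc k] @ [Suc k]" by (simp add: upt_conv_Cons)
  moreover have "map (\<lambda>s. if zz_at k a r s then zigzag else single_edge) [1..<Suc k] =
      map (Q_seg ?I) [1..<Suc k]"
    by (rule map_cong) (auto simp: zz_at_def Q_seg_def)
  moreover have "\<not> zz_at k a r 0" "\<not> zz_at k a r (Suc k)" by (auto simp: zz_at_def)
  ultimately have "zz_path (zz_at k a r) (k + 2) = single_edge @ concat (map (Q_seg ?I) [1..<Suc k]) @ single_edge"
    unfolding zz_path_def by (simp only: map_append list.map concat.simps concat_append if_False append_Nil2)
  then show ?thesis
    unfolding P_path_def Q_path_def k_def[symmetric] by simp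
qed

primrec code_pos :: "nat \<Rightarrow> 'a dvertex \<Rightarrow> 'a dvertex" where
  "code_pos k (Elem a) = Elem a"
| "code_pos k (Tup r) = Tup r"
| "code_pos k (Inner a r n) = Inner a r (zz_pos (zz_at k a r) n)"

primrec pos_code :: "nat \<Rightarrow> 'a dvertex \<Rightarrow> 'a dvertex" where
  "pos_code k (Elem a) = Elem a"
| "pos_code k (Tup r) = Tup r"
| "pos_code k (Inner a r i) =
     Inner a r (inv_into (zz_codes (zz_at k a r) (k + 2)) (zz_pos (zz_at k a r)) i)"

lemma code_pos_code_vertex:
  assumes "n \<in> zz_codes (zz_at (total_arity \<A>) a r) (total_arity \<A> + 2)"
  shows "code_pos (total_arity \<A>) (code_vertex (total_arity \<A>) a r n) =
      path_vertex \<A> a r (zz_pos (zz_at (total_arity \<A>) a r) n)"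
    and "pos_code (total_arity \<A>) (path_vertex \<A> a r (zz_pos (zz_at (total_arity \<A>) a r) n)) =
      code_vertex (total_arity \<A>) a r n"
proof -
  define k where "k = total_arity \<A>"
  let ?z = "zz_at k a r"
  let ?C = "zz_codes ?z (k + 2)"
  have n: "n \<in> ?C" using assms k_def by simp
  have inj: "inj_on (zz_pos ?z) ?C"
    using bij_zz_pos[of ?z "k + 2"] by (simp add: bij_betw_def)
  have C: "0 \<in> ?C" "3 * (k + 2) \<in> ?C" by (auto simp: zz_codes_def)
  have p0: "zz_pos ?z 0 = 0" by (simp add: zz_pos_def zz_path_def)
  have pN: "zz_pos ?z (3 * (k + 2)) = length (P_path \<A> a r)"
    by (simp only: zz_pos_3 P_path_zz_path k_def)
  \<comment> \<open>\<open>path_vertex\<close> recognises the ends by position and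
    \<open>code_vertex\<close> by code; injectivity makes the two tests agree.\<close>
  have 0: "zz_pos ?z n = 0 \<longleftrightarrow> n = 0"
    using inj_onD[OF inj _ n C(1)] p0 by auto
  have N: "zz_pos ?z n = length (P_path \<A> a r) \<longleftrightarrow> n = 3 * (k + 2)"
    using inj_onD[OF inj _ n C(2)] pN by auto
  show "code_pos (total_arity \<A>) (code_vertex (total_arity \<A>) a r n) =
      path_vertex \<A> a r (zz_pos (zz_at (total_arity \<A>) a r) n)"
    unfolding k_def[symmetric] using 0 N by (simp add: code_vertex_def path_vertex_def)
  show "pos_code (total_arity \<A>) (path_vertex \<A> a r (zz_pos (zz_at (total_arity \<A>) a r) n)) =
      code_vertex (total_arity \<A>) a r n"
    unfolding k_def[symmetric] using 0 N inv_into_f_f[OF inj n]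
    by (simp add: code_vertex_def path_vertex_def)
qed

lemma satisfies_D_digraph_coded:
  assumes "linear_identities \<Sigma>" "wf_identities ar \<Sigma>"
  shows "satisfies ar (D_digraph \<A>) \<Sigma> \<longleftrightarrow>
    satisfies ar (digraph (code_vertices (univ \<A>) (total_rel \<A>) (total_arity \<A>))
      (code_edges (univ \<A>) (total_rel \<A>) (total_arity \<A>))) \<Sigma>"
proof -
  define k where "k = total_arity \<A>"
  define A where "A = univ \<A>"
  define R where "R = total_rel \<A>"
  let ?V = "D_vertices \<A>" and ?E = "D_edges \<A>"
  let ?V' = "code_vertices A R k" and ?E' = "code_edges A R k"
  let ?z = "zz_at k"
  note conv = code_pos_code_vertex[where \<A> = \<A>, folded k_def]
  have pv: "\<exists>n \<in> zz_codes (?z a r) (k + 2). i = zz_pos (?z a r) n"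
    if "i \<le> length (P_path \<A> a r)" for a r i
  proof -
    have "i \<in> zz_pos (?z a r) ` zz_codes (?z a r) (k + 2)"
      using that bij_zz_pos[of "?z a r" "k + 2"]
      unfolding bij_betw_def P_path_zz_path k_def[symmetric] by simp
    then show ?thesis by blast
  qed
  have V: "?V = Elem ` A \<union> Tup ` R \<union> {path_vertex \<A> a r (zz_pos (?z a r) n) | a r n.
      a \<in> A \<and> r \<in> R \<and> n \<in> zz_codes (?z a r) (k + 2)}"
  proof -
    have "zz_pos (?z a r) n \<le> length (P_path \<A> a r)" if "n \<in> zz_codes (?z a r) (k + 2)" for a r n
      using that bij_zz_pos[of "?z a r" "k + 2"]
      unfolding bij_betw_def P_path_zz_path k_def[symmetric] by auto
    then show ?thesis unfolding D_vertices_def A_def R_def using pv by blast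
  qed
  have E: "?E = {(path_vertex \<A> a r (zz_pos (?z a r) m), path_vertex \<A> a r (zz_pos (?z a r) n)) | a r m n.
      a \<in> A \<and> r \<in> R \<and> (m, n) \<in> zz_edges (?z a r) (k + 2)}"
    unfolding D_edges_def P_path_zz_path k_def[symmetric] A_def R_def path_edges_zz_path by force
  have fwd: "code_pos k x \<in> ?V \<and> pos_code k (code_pos k x) = x" if "x \<in> ?V'" for x
    using that conv unfolding V code_vertices_def by fastforce
  have bwd: "pos_code k y \<in> ?V' \<and> code_pos k (pos_code k y) = y" if "y \<in> ?V" for y
    using that conv unfolding V code_vertices_def by fastforce
  have fwdE: "(code_pos k x, code_pos k y) \<in> ?E" if xy: "(x, y) \<in> ?E'" for x y
  proof -
    obtain a r m n where *: "x = code_vertex k a r m" "y = code_vertex k a r n"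
      "a \<in> A" "r \<in> R" "(m, n) \<in> zz_edges (?z a r) (k + 2)"
      using xy unfolding code_edges_def by blast
    then show ?thesis using conv(1) zz_edges_codes[OF *(5)] unfolding E by auto
  qed
  have bwdE: "(pos_code k x, pos_code k y) \<in> ?E'" if xy: "(x, y) \<in> ?E" for x y
  proof -
    obtain a r m n where *: "x = path_vertex \<A> a r (zz_pos (?z a r) m)"
      "y = path_vertex \<A> a r (zz_pos (?z a r) n)"
      "a \<in> A" "r \<in> R" "(m, n) \<in> zz_edges (?z a r) (k + 2)"
      using xy unfolding E by blast
    then show ?thesis using conv(2) zz_edges_codes[OF *(5)] unfolding code_edges_def by auto
  qed
  show ?thesis
    unfolding D_digraph_def A_def[symmetric] R_def[symmetric] k_def[symmetric]
    using satisfies_digraph_retract[OF assms, of ?V "pos_code k" ?V' ?E ?E' "code_pos k"]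
      satisfies_digraph_retract[OF assms, of ?V' "code_pos k" ?V ?E' ?E "pos_code k"]
      fwd bwd fwdE bwdE by blast
qed


section \<open>Elements, tuples, codes and levels of coded vertices\<close>

primrec (nonexhaustive) elem_of :: "'a dvertex \<Rightarrow> 'a" where
  "elem_of (Elem a) = a"
| "elem_of (Inner a r n) = a"

text \<open>The ends of a path are shared by many paths: \<open>tup_of\<close> of an
  \<open>Elem\<close> and \<open>elem_of\<close> of a \<open>Tup\<close> are unspecified. This is
  the source of all side conditions on levels \<open>0\<close> and \<open>k + 2\<close>.\<close>

primrec (nonexhaustive) tup_of :: "'a dvertex \<Rightarrow> 'a list" where
  "tup_of (Tup r) = r"
| "tup_of (Inner a r n) = r"

primrec code_of :: "nat \<Rightarrow> 'a dvertex \<Rightarrow> nat" where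
  "code_of k (Elem a) = 0"
| "code_of k (Tup r) = 3 * (k + 2)"
| "code_of k (Inner a r n) = n"

text \<open>Height above the elements. Along a zigzag the offsets \<open>0\<close>,
  \<open>1\<close>, \<open>2\<close>, \<open>3\<close> have relative heights \<open>0\<close>,
  \<open>1\<close>, \<open>0\<close>, \<open>1\<close>, so offset \<open>1\<close> is the one that
  exceeds the number of segments passed.\<close>

definition level :: "nat \<Rightarrow> 'a dvertex \<Rightarrow> nat" where
  "level k v = code_of k v div 3 + (if code_of k v mod 3 = 1 then 1 else 0)"

lemma code_of_code_vertex [simp]: "code_of k (code_vertex k a r n) = n"
  by (simp add: code_vertex_def)

lemma elem_of_code_vertex: "n < 3 * (k + 2) \<Longrightarrow> elem_of (code_vertex k a r n) = a"
  by (simp add: code_vertex_def)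

lemma tup_of_code_vertex: "0 < n \<Longrightarrow> tup_of (code_vertex k a r n) = r"
  by (simp add: code_vertex_def)

lemma code_vertices_cases:
  assumes "v \<in> code_vertices A R k" "A \<noteq> {}" "R \<noteq> {}"
  obtains a r n where "a \<in> A" "r \<in> R" "n \<in> zz_codes (zz_at k a r) (k + 2)" "v = code_vertex k a r n"
proof -
  obtain a0 r0 where *: "a0 \<in> A" "r0 \<in> R" using assms by blast
  have "0 \<in> zz_codes z (k + 2)" "3 * (k + 2) \<in> zz_codes z (k + 2)" for z
    by (auto simp: zz_codes_def)
  moreover have "Elem a = code_vertex k a r0 0" "Tup r = code_vertex k a0 r (3 * (k + 2))" for a r
    by (simp_all add: code_vertex_def)
  ultimately show thesis using assms(1) * that unfolding code_vertices_def by blast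
qed

lemma code_vertex_in:
  "a \<in> A \<Longrightarrow> r \<in> R \<Longrightarrow> n \<in> zz_codes (zz_at k a r) (k + 2) \<Longrightarrow> code_vertex k a r n \<in> code_vertices A R k"
  unfolding code_vertices_def by blast

abbreviation segment_edges :: "bool \<Rightarrow> (nat \<times> nat) set" where
  "segment_edges b \<equiv> (if b then {(0, 1), (2, 1), (2, 3)} else {(0, 3)})"

lemma code_edges_cases:
  assumes "(u, v) \<in> code_edges A R k"
  obtains a r s i j where "a \<in> A" "r \<in> R" "s < k + 2"
    "u = code_vertex k a r (3 * s + i)" "v = code_vertex k a r (3 * s + j)"
    "(i, j) \<in> segment_edges (zz_at k a r s)"
proof -
  obtain a r m n s where *: "a \<in> A" "r \<in> R" "s < k + 2" "u = code_vertex k a r m" "v = code_vertex k a r n"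
    "(m, n) \<in> (if zz_at k a r s then {(3 * s, 3 * s + 1), (3 * s + 2, 3 * s + 1), (3 * s + 2, 3 * s + 3)}
                          else {(3 * s, 3 * s + 3)})"
    using assms unfolding code_edges_def zz_edges_def by blast
  then have "m = 3 * s + (m - 3 * s)" "n = 3 * s + (n - 3 * s)"
    "(m - 3 * s, n - 3 * s) \<in> segment_edges (zz_at k a r s)"
    by (auto split: if_splits)
  then show thesis using that * by metis
qed

lemma code_edgesI:
  assumes "a \<in> A" "r \<in> R" "s < k + 2" "(i, j) \<in> segment_edges (zz_at k a r s)"
  shows "(code_vertex k a r (3 * s + i), code_vertex k a r (3 * s + j)) \<in> code_edges A R k"
proof -
  have "(3 * s + i, 3 * s + j) \<in> zz_edges (zz_at k a r) (k + 2)"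
    unfolding zz_edges_def using assms by (intro UN_I[of s]) (auto split: if_splits)
  then show ?thesis unfolding code_edges_def using assms by blast
qed

lemma level_code_vertex:
  "level k (code_vertex k a r (3 * s)) = s" "level k (code_vertex k a r (3 * s + 1)) = Suc s"
  "level k (code_vertex k a r (3 * s + 2)) = s" "level k (code_vertex k a r (3 * s + 3)) = Suc s"
  by (simp_all add: level_def)

text \<open>Within its segment an edge runs from offset \<open>0\<close> or \<open>2\<close> to
  offset \<open>1\<close> or \<open>3\<close>. Its ends lie on a common path, so they share the
  element unless the target is a \<open>Tup\<close>, and the tuple unless the source is an
  \<open>Elem\<close>.\<close>

lemma code_edges_level:
  assumes "(u, v) \<in> code_edges A R k"
  shows "level k v = Suc (level k u)" "level k u < k + 2"
    and "level k v < k + 2 \<Longrightarrow> elem_of u = elem_of v"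
    and "0 < level k u \<Longrightarrow> tup_of u = tup_of v"
    and "code_of k u mod 3 \<noteq> 1" "code_of k v mod 3 \<noteq> 2"
proof -
  obtain a r s i j where *: "s < k + 2"
    "u = code_vertex k a r (3 * s + i)" "v = code_vertex k a r (3 * s + j)"
    "(i, j) \<in> segment_edges (zz_at k a r s)"
    using assms by (rule code_edges_cases)
  have ij: "i = 0 \<or> i = 2" "j = 1 \<or> j = 3" using *(4) by (auto split: if_splits)
  have lev: "level k u = s" "level k v = Suc s"
    using ij * level_code_vertex[of k a r s] by auto
  then show "level k v = Suc (level k u)" "level k u < k + 2" using *(1) by auto
  show "elem_of u = elem_of v" if "level k v < k + 2"
  proof -
    have "3 * s + i < 3 * (k + 2)" "3 * s + j < 3 * (k + 2)" using that lev ij by auto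
    then show ?thesis using * by (simp add: elem_of_code_vertex)
  qed
  show "tup_of u = tup_of v" if "0 < level k u"
    using that lev * by (simp add: tup_of_code_vertex)
  show "code_of k u mod 3 \<noteq> 1" "code_of k v mod 3 \<noteq> 2" using * ij by auto
qed

lemma zz_codes_level:
  assumes "n \<in> zz_codes (zz_at k a r) (k + 2)" "v = code_vertex k a r n"
  shows "level k v \<le> k + 2" "level k v = 0 \<longleftrightarrow> n = 0" "level k v = k + 2 \<longleftrightarrow> n = 3 * (k + 2)"
proof -
  have n: "n \<le> 3 * (k + 2)" "n mod 3 = 0 \<or> 1 \<le> n div 3 \<and> n div 3 \<le> k"
    using assms(1) by (auto simp: zz_codes_def zz_at_def)
  have lev: "level k v = n div 3 + (if n mod 3 = 1 then 1 else 0)"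
    unfolding level_def assms(2) by simp
  have "n = 3 * (n div 3) + n mod 3" by simp
  then show "level k v \<le> k + 2" "level k v = 0 \<longleftrightarrow> n = 0" "level k v = k + 2 \<longleftrightarrow> n = 3 * (k + 2)"
    using n unfolding lev by (auto split: if_splits)
qed

lemma code_vertices_level:
  assumes "v \<in> code_vertices A R k" "A \<noteq> {}" "R \<noteq> {}"
  shows "level k v \<le> k + 2" "level k v = 0 \<Longrightarrow> v \<in> Elem ` A" "level k v = k + 2 \<Longrightarrow> v \<in> Tup ` R"
proof -
  obtain a r n where *: "a \<in> A" "r \<in> R" "n \<in> zz_codes (zz_at k a r) (k + 2)" "v = code_vertex k a r n"
    using assms by (rule code_vertices_cases)
  note lev = zz_codes_level[OF *(3,4)]
  show "level k v \<le> k + 2" by (fact lev)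
  show "v \<in> Elem ` A" if "level k v = 0" using that lev * by (simp add: code_vertex_def)
  show "v \<in> Tup ` R" if "level k v = k + 2" using that lev * by (simp add: code_vertex_def)
qed


section \<open>From the digraph to the structure\<close>

text \<open>The homomorphism from the path with zigzags everywhere onto the given one. An edge
  segment is traversed forth, back and forth: offset \<open>1\<close> goes to its end
  (\<open>m + 2\<close>), offset \<open>2\<close> to its start (\<open>m - 2\<close>).\<close>

definition fold_code :: "(nat \<Rightarrow> bool) \<Rightarrow> nat \<Rightarrow> nat" where
  "fold_code z m = (if z (m div 3) \<or> m mod 3 = 0 then m else if m mod 3 = 1 then m + 2 else m - 2)"

text \<open>The images of the all-zigzag walks from the elements of \<open>as\<close> to the tuples in \<open>rs\<close> climb
  \<open>k + 2\<close> levels, so they must run from an element to a tuple. Each vertex between two segments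
  has both a predecessor and a successor, which pins down its code; so if a segment of the walk
  can be shortcut by a single edge, the corresponding segment of the digraph is an edge.\<close>

lemma polymorphism_code_endpoints:
  assumes f: "polymorphism (digraph (code_vertices A R k) (code_edges A R k)) n f"
    and ne: "A \<noteq> {}" "R \<noteq> {}"
    and as: "length as = n" "set as \<subseteq> A" and rs: "length rs = n" "set rs \<subseteq> R"
  shows "\<exists>a \<in> A. \<exists>r \<in> R. f (map Elem as) = Elem a \<and> f (map Tup rs) = Tup r \<and>
           (\<forall>l < k. as = map (\<lambda>r. r ! l) rs \<longrightarrow> a = r ! l)"
proof -
  let ?V = "code_vertices A R k" and ?E = "code_edges A R k"
  \<comment> \<open>The walks of all pairs advance in parallel through the same codes
    \<open>m\<close>; \<open>W\<close> is their image under \<open>f\<close>.\<close>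
  define w where "w m = map2 (\<lambda>a r. code_vertex k a r (fold_code (zz_at k a r) m)) as rs" for m
  define W where "W m = f (w m)" for m
  have w0: "w 0 = map Elem as" and wN: "w (3 * (k + 2)) = map Tup rs"
    using as rs by (auto simp: w_def fold_code_def code_vertex_def intro!: nth_equalityI)
  have fE: "(f us, f vs) \<in> ?E" if "length us = n" "list_all2 (\<lambda>u v. (u, v) \<in> ?E) us vs" for us vs
    using f that by (simp add: polymorphism_digraph_iff)
  have wE: "(W m, W m') \<in> ?E"
    if "\<And>a r. (a, r) \<in> set (zip as rs) \<Longrightarrow> a \<in> A \<Longrightarrow> r \<in> R \<Longrightarrow>
      (code_vertex k a r (fold_code (zz_at k a r) m), code_vertex k a r (fold_code (zz_at k a r) m')) \<in> ?E"
    for m m'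
  proof -
    have "as ! i \<in> A" "rs ! i \<in> R" if "i < n" for i using that as rs by auto
    moreover have "(as ! i, rs ! i) \<in> set (zip as rs)" if "i < n" for i
      using that as rs by (auto simp: in_set_zip)
    ultimately show ?thesis
      unfolding W_def using that as rs by (intro fE) (auto simp: w_def list_all2_conv_all_nth)
  qed
  have walk: "(W (3 * s), W (3 * s + 1)) \<in> ?E" "(W (3 * s + 2), W (3 * s + 1)) \<in> ?E"
    "(W (3 * s + 2), W (3 * Suc s)) \<in> ?E" if s: "s < k + 2" for s
  proof -
    have fold: "fold_code z (3 * s) = 3 * s + 0"
      "fold_code z (3 * s + 1) = 3 * s + (if z s then 1 else 3)"
      "fold_code z (3 * s + 2) = 3 * s + (if z s then 2 else 0)"
      "fold_code z (3 * Suc s) = 3 * s + 3" for z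
      by (simp_all add: fold_code_def)
    show "(W (3 * s), W (3 * s + 1)) \<in> ?E" "(W (3 * s + 2), W (3 * s + 1)) \<in> ?E"
      "(W (3 * s + 2), W (3 * Suc s)) \<in> ?E"
      by (rule wE, unfold fold, rule code_edgesI[OF _ _ s]; simp)+
  qed
  have lev_step: "level k (W (3 * Suc s)) = Suc (level k (W (3 * s)))" if "s < k + 2" for s
    using walk[OF that] code_edges_level(1) by metis
  have lev_add: "s \<le> k + 2 \<Longrightarrow> level k (W (3 * s)) = level k (W 0) + s" for s
    by (induction s) (use lev_step in auto)
  have WV: "W 0 \<in> ?V" "W (3 * (k + 2)) \<in> ?V"
  proof -
    have "set (map Elem as) \<subseteq> ?V" "set (map Tup rs) \<subseteq> ?V"
      using as rs by (auto simp: code_vertices_def)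
    then show "W 0 \<in> ?V" "W (3 * (k + 2)) \<in> ?V"
      unfolding W_def w0 wN using f as rs by (auto simp: polymorphism_digraph_iff)
  qed
  \<comment> \<open>The image climbs \<open>k + 2\<close> levels and no vertex lies higher than
    that, so it starts at level \<open>0\<close>.\<close>
  have lev0: "level k (W 0) = 0"
    using lev_add[of "k + 2"] code_vertices_level(1)[OF WV(2) ne] by simp
  then have lev: "level k (W (3 * s)) = s" if "s \<le> k + 2" for s using lev_add that by simp
  obtain a where a: "a \<in> A" "W 0 = Elem a" using code_vertices_level(2)[OF WV(1) ne lev0] by blast
  obtain r where r: "r \<in> R" "W (3 * (k + 2)) = Tup r"
    using code_vertices_level(3)[OF WV(2) ne lev[OF order_refl]] by blast
  \<comment> \<open>The element is carried upwards from the start as far as level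
    \<open>k + 1\<close>; below, the tuple is carried downwards from the end as far as level
    \<open>1\<close>.\<close>
  have elem: "s \<le> k + 1 \<Longrightarrow> elem_of (W (3 * s)) = a" for s
  proof (induction s)
    case (Suc s)
    then have s: "s < k + 2" by simp
    have "level k (W (3 * s + 1)) = Suc s" "level k (W (3 * Suc s)) = Suc s"
      using code_edges_level(1)[OF walk(1)[OF s]] lev[of s] lev[of "Suc s"] Suc.prems s by auto
    then have "elem_of (W (3 * s)) = elem_of (W (3 * s + 1))"
      "elem_of (W (3 * s + 2)) = elem_of (W (3 * s + 1))"
      "elem_of (W (3 * s + 2)) = elem_of (W (3 * Suc s))"
      using code_edges_level(3) walk[OF s] Suc.prems by (metis Suc_eq_plus1 Suc_le_mono add_2_eq_Suc' le_imp_less_Suc)+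
    then show ?case using Suc by simp
  qed (use a in simp)
  have tup: "tup_of (W (3 * s)) = r" if "1 \<le> s" "s \<le> k + 2" for s
    using that(2,1)
  proof (induction s rule: inc_induct)
    case (step s)
    have s: "s < k + 2" by fact
    note st = walk[OF s]
    have "level k (W (3 * s)) = s" "level k (W (3 * s + 2)) = s"
      using code_edges_level(1)[OF st(1)] code_edges_level(1)[OF st(2)] lev[of s] s by auto
    then have "tup_of (W (3 * s)) = tup_of (W (3 * s + 1))"
      "tup_of (W (3 * s + 2)) = tup_of (W (3 * s + 1))"
      "tup_of (W (3 * s + 2)) = tup_of (W (3 * Suc s))"
      using code_edges_level(4) st step.prems by (metis zero_less_iff_neq_zero not_one_le_zero)+
    then show ?case using step by simp
  qed (use r in simp)
  have "a = r ! l" if l: "l < k" and as_l: "as = map (\<lambda>r. r ! l) rs" for l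
  proof (rule ccontr)
    assume "a \<noteq> r ! l"
    then have zz: "zz_at k a r (Suc l)" using l by (simp add: zz_at_def)
    have "\<not> zz_at k b t (Suc l)" if "(b, t) \<in> set (zip as rs)" for b t
      using that unfolding as_l by (auto simp: zz_at_def in_set_zip)
    note no_zz = this
    \<comment> \<open>List position \<open>l\<close> belongs to segment \<open>Suc l\<close>. All
      pairs have a single edge there, so the walks may cross it in one step, and so may their
      image.\<close>
    have "(W (3 * Suc l), W (3 * Suc l + 3)) \<in> ?E"
    proof (intro wE)
      fix b t assume *: "(b, t) \<in> set (zip as rs)" "b \<in> A" "t \<in> R"
      have "fold_code z (3 * Suc l) = 3 * Suc l + 0" "fold_code z (3 * Suc l + 3) = 3 * Suc l + 3" for z
        by (simp_all add: fold_code_def)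
      then show "(code_vertex k b t (fold_code (zz_at k b t) (3 * Suc l)),
          code_vertex k b t (fold_code (zz_at k b t) (3 * Suc l + 3))) \<in> ?E"
        using code_edgesI[OF *(2,3), of "Suc l" k 0 3] no_zz[OF *(1)] l by simp
    qed
    then obtain b t s i j where *: "s < k + 2"
      "W (3 * Suc l) = code_vertex k b t (3 * s + i)" "W (3 * Suc l + 3) = code_vertex k b t (3 * s + j)"
      "(i, j) \<in> segment_edges (zz_at k b t s)"
      by (rule code_edges_cases)
    have ij: "i = 0 \<or> i = 2" "j = 1 \<or> j = 3" using *(4) by (auto split: if_splits)
    have s: "s = Suc l"
      using ij(1) lev[of "Suc l"] l *(2) level_code_vertex[of k b t s] by auto
    have "b = a" using elem[of "Suc l"] l ij(1) s *(2) by (auto simp: elem_of_code_vertex)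
    moreover have "t = r" using tup[of "Suc l"] l ij(1) s *(2) by (auto simp: tup_of_code_vertex)
    \<comment> \<open>A zigzag has no edge from offset \<open>0\<close> to offset \<open>3\<close>.
      The two remaining possibilities contradict the walk entering the first vertex and leaving the
      second.\<close>
    ultimately have "i = 2 \<or> j = 1" using *(4) zz s by auto
    moreover have "code_of k (W (3 * Suc l)) mod 3 \<noteq> 2"
      using code_edges_level(6)[OF walk(3)[of l]] l by simp
    moreover have "code_of k (W (3 * Suc (Suc l))) mod 3 \<noteq> 1"
      using code_edges_level(5)[OF walk(1)[of "Suc (Suc l)"]] l by simp
    moreover have "3 * Suc (Suc l) = 3 * Suc l + 3" by simp
    ultimately show False using *(2,3) by (metis code_of_code_vertex code_div_mod(4,5) Suc_1 add_2_eq_Suc' Suc_eq_plus1)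
  qed
  then show ?thesis using a r w0 wN unfolding W_def by auto
qed

lemma finite_rel_structure_rels:
  assumes "finite_rel_structure \<A>"
  shows "\<forall>(k, R) \<in> set (rels \<A>). R \<noteq> {} \<and> (\<forall>t \<in> R. length t = k)"
    and "\<forall>(k, R) \<in> set (rels \<A>). finite R"
    and "r \<in> total_rel \<A> \<Longrightarrow> set r \<subseteq> univ \<A>"
    and "r \<in> total_rel \<A> \<Longrightarrow> length r = total_arity \<A>"
    and "finite (total_rel \<A>)" "total_rel \<A> \<noteq> {}" "univ \<A> \<noteq> {}"
proof -
  have rels: "k \<ge> 1 \<and> R \<noteq> {} \<and> R \<subseteq> {t. length t = k \<and> set t \<subseteq> univ \<A>}"
    if "(k, R) \<in> set (rels \<A>)" for k R
    using assms that unfolding finite_rel_structure_def by blast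
  have fin: "finite (univ \<A>)" and ne: "rels \<A> \<noteq> []"
    using assms by (auto simp: finite_rel_structure_def)
  show 1: "\<forall>(k, R) \<in> set (rels \<A>). R \<noteq> {} \<and> (\<forall>t \<in> R. length t = k)"
    using rels by blast
  show 2: "\<forall>(k, R) \<in> set (rels \<A>). finite R"
  proof clarify
    fix k R assume "(k, R) \<in> set (rels \<A>)"
    then have "R \<subseteq> {t. set t \<subseteq> univ \<A> \<and> length t = k}" using rels by blast
    then show "finite R" using finite_lists_length_eq[OF fin] finite_subset by blast
  qed
  have total: "total_rel \<A> = product_rel (rels \<A>)"
    by (simp add: total_rel_def product_rel_def)
  have "(\<forall>(k, R) \<in> set rs. \<forall>t \<in> R. set t \<subseteq> univ \<A>) \<Longrightarrow> r \<in> product_rel rs \<Longrightarrow> set r \<subseteq> univ \<A>" for rs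
  proof (induction rs arbitrary: r)
    case (Cons p rs)
    obtain k R where p: "p = (k, R)" by (cases p)
    obtain t r' where r: "r = t @ r'" "t \<in> R" "r' \<in> product_rel rs"
      using Cons.prems(2) unfolding p product_rel_Cons by blast
    have "set t \<subseteq> univ \<A>" using Cons.prems(1) r(2) p by simp
    moreover have "set r' \<subseteq> univ \<A>" using Cons.IH[of r'] Cons.prems(1) r(3) by simp
    ultimately show ?case using r(1) by simp
  qed simp
  then show "r \<in> total_rel \<A> \<Longrightarrow> set r \<subseteq> univ \<A>" using rels unfolding total by blast
  show "r \<in> total_rel \<A> \<Longrightarrow> length r = total_arity \<A>"
    using length_product_rel[of "rels \<A>" r] 1 unfolding total total_arity_def by blast
  show "finite (total_rel \<A>)" unfolding total using 2 by (rule finite_product_rel)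
  show "total_rel \<A> \<noteq> {}" unfolding total using 1 by (intro product_rel_nonempty) blast
  obtain k R where kR: "(k, R) \<in> set (rels \<A>)" using ne by (cases "rels \<A>") auto
  obtain t where "t \<in> R" using rels[OF kR] by blast
  then have "set t \<subseteq> univ \<A>" "t \<noteq> []" using rels[OF kR] by auto
  then show "univ \<A> \<noteq> {}" by auto
qed

text \<open>The operations are restricted to elements. A relation of \<A> is preserved because its
  tuples extend to tuples of the product, \<open>I f\<close> sends these to some
  \<open>Tup r\<close>, and each entry of \<open>r\<close> is the value of \<open>J f\<close> at the
  corresponding entries.\<close>

lemma satisfies_of_code_digraph:
  assumes fin: "finite_rel_structure \<A>"
    and lin: "linear_identities \<Sigma>"
    and sat: "satisfies ar (digraph (code_vertices (univ \<A>) (total_rel \<A>) (total_arity \<A>))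
      (code_edges (univ \<A>) (total_rel \<A>) (total_arity \<A>))) \<Sigma>"
  shows "satisfies ar \<A> \<Sigma>"
proof -
  let ?A = "univ \<A>" and ?R = "total_rel \<A>" and ?k = "total_arity \<A>"
  let ?G = "digraph (code_vertices ?A ?R ?k) (code_edges ?A ?R ?k)"
  note rels = finite_rel_structure_rels[OF fin]
  have total: "?R = product_rel (rels \<A>)"
    by (simp add: total_rel_def product_rel_def)
  obtain I where I: "\<And>f. f \<in> symbols_of \<Sigma> \<Longrightarrow> polymorphism ?G (ar f) (I f)"
    "\<And>u v \<sigma>. (u, v) \<in> \<Sigma> \<Longrightarrow> range \<sigma> \<subseteq> code_vertices ?A ?R ?k \<Longrightarrow> eval_trm I \<sigma> u = eval_trm I \<sigma> v"
    using sat by (fastforce simp: satisfies_def digraph_def)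
  define J where "J f xs = elem_of (I f (map Elem xs))" for f xs
  have "polymorphism \<A> (ar f) (J f)" if f: "f \<in> symbols_of \<Sigma>" for f
  proof -
    have ends: "\<exists>r \<in> ?R. J f as \<in> ?A \<and> I f (map Tup rs) = Tup r \<and>
        (\<forall>l < ?k. as = map (\<lambda>r. r ! l) rs \<longrightarrow> J f as = r ! l)"
      if "length as = ar f" "set as \<subseteq> ?A" "length rs = ar f" "set rs \<subseteq> ?R" for as rs
      using polymorphism_code_endpoints[OF I(1)[OF f] rels(7,6) that] by (auto simp: J_def)
    show ?thesis
      unfolding polymorphism_def
    proof (intro conjI allI impI ballI, goal_cases)
      case (1 xs)
      obtain r0 where "r0 \<in> ?R" using rels(6) by blast
      then show ?case using ends[of xs "replicate (ar f) r0"] 1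
        by (auto simp: set_replicate_conv_if)
    next
      case (2 q)
      obtain \<kappa> S where q: "q = (\<kappa>, S)" by (cases q)
      obtain p where p: "p + \<kappa> \<le> ?k" "\<And>t. t \<in> S \<Longrightarrow> \<exists>r \<in> ?R. \<forall>i < \<kappa>. r ! (p + i) = t ! i"
        "\<And>r. r \<in> ?R \<Longrightarrow> map (\<lambda>i. r ! (p + i)) [0..<\<kappa>] \<in> S"
      proof -
        have "(\<kappa>, S) \<in> set (rels \<A>)" using 2 q by simp
        from product_rel_block[OF rels(1) this, folded total total_arity_def]
        show thesis using that by metis
      qed
      then obtain g where g: "\<And>t. t \<in> S \<Longrightarrow> g t \<in> ?R \<and> (\<forall>i < \<kappa>. g t ! (p + i) = t ! i)" by metis
      have "map (\<lambda>i. J f (map (\<lambda>t. t ! i) ts)) [0..<\<kappa>] \<in> S"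
        if ts: "length ts = ar f" "set ts \<subseteq> S" for ts
      proof -
        have rs: "length (map g ts) = ar f" "set (map g ts) \<subseteq> ?R" using ts g by auto
        have sub: "set (map (\<lambda>r. r ! l) (map g ts)) \<subseteq> ?A" if "l < ?k" for l
        proof -
          have "r ! l \<in> ?A" if "r \<in> ?R" for r
            using rels(3)[OF that] rels(4)[OF that] \<open>l < ?k\<close> by (auto simp: subset_iff)
          then show ?thesis using rs(2) by auto
        qed
        \<comment> \<open>The tuples alone determine \<open>r\<close>, so one \<open>r\<close>
          serves all coordinates; the elements \<open>a0\<close> are placeholders.\<close>
        obtain r where r: "r \<in> ?R" "I f (map Tup (map g ts)) = Tup r"
        proof -
          obtain a0 where "a0 \<in> ?A" using rels(7) by blast
          then have "length (replicate (ar f) a0) = ar f" "set (replicate (ar f) a0) \<subseteq> ?A"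
            by (auto simp: set_replicate_conv_if)
          from ends[OF this rs] show thesis using that by blast
        qed
        have "J f (map (\<lambda>t. t ! i) ts) = r ! (p + i)" if i: "i < \<kappa>" for i
        proof -
          have "p + i < ?k" using p(1) i by simp
          then have "J f (map (\<lambda>r. r ! (p + i)) (map g ts)) = r ! (p + i)"
            using ends[OF _ sub rs, of "p + i"] r(2) rs(1) by auto
          moreover have "map (\<lambda>r. r ! (p + i)) (map g ts) = map (\<lambda>t. t ! i) ts"
            using g ts i by auto
          ultimately show ?thesis by (simp only:)
        qed
        then have "map (\<lambda>i. J f (map (\<lambda>t. t ! i) ts)) [0..<\<kappa>] = map (\<lambda>i. r ! (p + i)) [0..<\<kappa>]"
          by (intro map_cong) auto
        then show ?thesis using p(3)[OF r(1)] by (simp only:)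
      qed
      then show ?case using q by blast
    qed
  qed
  moreover have "eval_trm J \<sigma> u = eval_trm J \<sigma> v"
    if uv: "(u, v) \<in> \<Sigma>" and \<sigma>: "range \<sigma> \<subseteq> ?A" for u v \<sigma>
  proof -
    have J: "eval_trm J \<sigma> t = elem_of (eval_trm I (Elem \<circ> \<sigma>) t)" if t: "symbol_occs t \<le> 1" for t
      by (cases t) (use eval_trm_linear[OF t, of J \<sigma>] eval_trm_linear[OF t, of I "Elem \<circ> \<sigma>"] in
        \<open>simp_all add: J_def comp_assoc del: eval_trm.simps(2)\<close>)
    have "symbol_occs u \<le> 1" "symbol_occs v \<le> 1"
      using lin uv by (auto simp: linear_identities_def linear_identity_def)
    moreover have "eval_trm I (Elem \<circ> \<sigma>) u = eval_trm I (Elem \<circ> \<sigma>) v"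
      using I(2)[OF uv] \<sigma> by (auto simp: image_subset_iff code_vertices_def)
    ultimately show ?thesis using J by simp
  qed
  ultimately show ?thesis unfolding satisfies_def by (intro exI[of _ J]) auto
qed


section \<open>Lifting an operation to the digraph\<close>

text \<open>Vertices with code \<open>1\<close> modulo 3 have no successor and those with code \<open>2\<close> modulo 3 no
  predecessor, so arguments on one level that are not central lie on no edge at all.\<close>

definition central :: "nat \<Rightarrow> 'a dvertex set \<Rightarrow> bool" where
  "central k S \<longleftrightarrow> (\<exists>l. level k ` S = {l}) \<and>
     \<not> (\<exists>u \<in> S. \<exists>v \<in> S. code_of k u mod 3 = 1 \<and> code_of k v mod 3 = 2)"

definition central_level :: "nat \<Rightarrow> 'a dvertex set \<Rightarrow> nat" where
  "central_level k S = the_elem (level k ` S)"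

text \<open>At level \<open>l\<close> the codes are \<open>3 * l\<close>, then
  \<open>3 * l + 2\<close> in segment \<open>l\<close>, and \<open>3 * l - 2\<close> in segment
  \<open>l - 1\<close>. Centrality keeps the last two from occurring together, so one segment holds
  all arguments; if all are at \<open>3 * l\<close>, segment \<open>l\<close> is chosen.\<close>

definition central_segment :: "nat \<Rightarrow> 'a dvertex set \<Rightarrow> nat" where
  "central_segment k S =
     (if \<exists>v \<in> S. code_of k v mod 3 = 1 then central_level k S - 1 else central_level k S)"

definition zz_vertex :: "nat \<Rightarrow> nat \<Rightarrow> 'a dvertex \<Rightarrow> bool" where
  "zz_vertex k s v \<longleftrightarrow> zz_at k (elem_of v) (tup_of v) s"

definition lift_elem :: "('a list \<Rightarrow> 'a) \<Rightarrow> 'a dvertex list \<Rightarrow> 'a" where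
  "lift_elem g xs = g (map elem_of xs)"

definition lift_tup :: "nat \<Rightarrow> ('a list \<Rightarrow> 'a) \<Rightarrow> 'a dvertex list \<Rightarrow> 'a list" where
  "lift_tup k g xs = map (\<lambda>i. g (map (\<lambda>v. tup_of v ! i) xs)) [0..<k]"

text \<open>On an edge segment the level alone fixes the position. The minimum is a legitimate
  choice in a zigzag because it preserves the edges: a least source at offset \<open>0\<close> has
  its target at offset \<open>1\<close>, so the pair of offsets \<open>0\<close> and
  \<open>3\<close> cannot arise.\<close>

definition segment_code :: "nat \<Rightarrow> ('a list \<Rightarrow> 'a) \<Rightarrow> (nat list \<Rightarrow> nat) \<Rightarrow> nat \<Rightarrow> 'a dvertex list \<Rightarrow> nat" where
  "segment_code k g h s xs =
     (if zz_at k (lift_elem g xs) (lift_tup k g xs) s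
      then if \<forall>v \<in> set xs. zz_vertex k s v
           then 3 * s + h (map (\<lambda>v. code_of k v - 3 * s) xs)
           else Min (code_of k ` {v \<in> set xs. zz_vertex k s v})
      else 3 * central_level k (set xs))"

definition central_op :: "nat \<Rightarrow> ('a list \<Rightarrow> 'a) \<Rightarrow> (nat list \<Rightarrow> nat) \<Rightarrow> 'a dvertex list \<Rightarrow> 'a dvertex" where
  "central_op k g h xs = code_vertex k (lift_elem g xs) (lift_tup k g xs)
     (segment_code k g h (central_segment k (set xs)) xs)"

text \<open>Arguments on one level that are not central are split into those in the lower segment
  (offset \<open>1\<close>) and the rest; on several levels the lowest is split off. Both groups are
  then inhabited, so two distinct vertices form two singletons.\<close>

definition low :: "nat \<Rightarrow> 'a dvertex set \<Rightarrow> 'a dvertex \<Rightarrow> bool" where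
  "low k S v \<longleftrightarrow> (if card (level k ` S) = 1 then code_of k v mod 3 = 1
                  else level k v = Min (level k ` S))"

text \<open>The element comes first in \<open>low_key\<close> and the tuple in \<open>high_key\<close> because edges out of an
  element preserve only the former, and edges into a tuple only the latter.\<close>

definition low_key :: "nat \<Rightarrow> ('a \<Rightarrow> nat) \<Rightarrow> ('a list \<Rightarrow> nat) \<Rightarrow> 'a dvertex \<Rightarrow> nat \<times> nat \<times> nat" where
  "low_key k eA eR v = (eA (elem_of v), eR (tup_of v), code_of k v)"

definition high_key :: "nat \<Rightarrow> ('a \<Rightarrow> nat) \<Rightarrow> ('a list \<Rightarrow> nat) \<Rightarrow> 'a dvertex \<Rightarrow> nat \<times> nat \<times> nat" where
  "high_key k eA eR v = (eR (tup_of v), eA (elem_of v), code_of k v)"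

text \<open>The marks \<open>0\<close> and \<open>2\<close> name the groups. Under an absorption law
  \<open>h\<close> returns the mark of the absorbed argument and thus selects its group.\<close>

definition split_op ::
  "nat \<Rightarrow> (nat list \<Rightarrow> nat) \<Rightarrow> ('a \<Rightarrow> nat) \<Rightarrow> ('a list \<Rightarrow> nat) \<Rightarrow> 'a dvertex list \<Rightarrow> 'a dvertex" where
  "split_op k h eA eR xs =
     (if card (level k ` set xs) \<le> 2 \<and> h (map (\<lambda>v. if low k (set xs) v then 0 else 2) xs) \<noteq> 0
      then arg_min_on (high_key k eA eR) {v \<in> set xs. \<not> low k (set xs) v}
      else arg_min_on (low_key k eA eR) {v \<in> set xs. low k (set xs) v})"

definition lift_op ::
  "nat \<Rightarrow> ('a \<Rightarrow> nat) \<Rightarrow> ('a list \<Rightarrow> nat) \<Rightarrow> ('a list \<Rightarrow> 'a) \<Rightarrow> (nat list \<Rightarrow> nat) \<Rightarrow> 'a dvertex list \<Rightarrow> 'a dvertex" where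
  "lift_op k eA eR g h xs = (if central k (set xs) then central_op k g h xs else split_op k h eA eR xs)"


section \<open>Identities pass to the lifted operations\<close>

locale code_digraph =
  fixes A :: "'a set" and R :: "'a list set" and k :: nat
  assumes A_ne: "A \<noteq> {}" and R_ne: "R \<noteq> {}"
    and R_tuples: "\<And>r. r \<in> R \<Longrightarrow> length r = k \<and> set r \<subseteq> A"
begin

abbreviation V :: "'a dvertex set" where "V \<equiv> code_vertices A R k"
abbreviation E :: "('a dvertex \<times> 'a dvertex) set" where "E \<equiv> code_edges A R k"

lemma vertex:
  assumes "v \<in> V"
  shows "level k v \<le> k + 2"
    and "level k v < k + 2 \<Longrightarrow> elem_of v \<in> A"
    and "0 < level k v \<Longrightarrow> tup_of v \<in> R"
    and "v = code_vertex k (elem_of v) (tup_of v) (code_of k v)"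
    and "code_of k v mod 3 \<noteq> 0 \<Longrightarrow> zz_vertex k (code_of k v div 3) v"
    and "level k v = 0 \<longleftrightarrow> code_of k v = 0" "level k v = k + 2 \<longleftrightarrow> code_of k v = 3 * (k + 2)"
proof -
  obtain a r n where *: "a \<in> A" "r \<in> R" "n \<in> zz_codes (zz_at k a r) (k + 2)" "v = code_vertex k a r n"
    using assms A_ne R_ne by (rule code_vertices_cases)
  have c: "code_of k v = n" using *(4) by simp
  have n: "n \<le> 3 * (k + 2)" using *(3) by (simp add: zz_codes_def)
  note lev = zz_codes_level[OF *(3,4)]
  show "level k v \<le> k + 2" by (fact lev)
  show "level k v = 0 \<longleftrightarrow> code_of k v = 0" "level k v = k + 2 \<longleftrightarrow> code_of k v = 3 * (k + 2)"
    using lev c by auto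
  have el: "elem_of v = a" if "n < 3 * (k + 2)" using that * by (simp add: elem_of_code_vertex)
  have tu: "tup_of v = r" if "0 < n" using that * by (simp add: tup_of_code_vertex)
  show "elem_of v \<in> A" if "level k v < k + 2" using el that lev n * by simp
  show "tup_of v \<in> R" if "0 < level k v" using tu that lev * by simp
  show "v = code_vertex k (elem_of v) (tup_of v) (code_of k v)"
    using el tu n c * by (simp add: code_vertex_def)
  show "zz_vertex k (code_of k v div 3) v" if "code_of k v mod 3 \<noteq> 0"
  proof -
    have m: "n mod 3 \<noteq> 0" using that c by simp
    then have "n \<noteq> 0" "n \<noteq> 3 * (k + 2)" by auto
    then have "elem_of v = a" "tup_of v = r" using el tu n by auto
    then show ?thesis using *(3) m c by (simp add: zz_codes_def zz_vertex_def)
  qed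
qed

lemma codes_at_level:
  assumes "level k v = l"
  shows "code_of k v = 3 * l \<or> code_of k v = 3 * l + 2 \<or> (0 < l \<and> code_of k v + 2 = 3 * l)"
proof -
  define q where "q = code_of k v div 3"
  define m where "m = code_of k v mod 3"
  have "code_of k v = 3 * q + m" "m = 0 \<or> m = 1 \<or> m = 2" by (auto simp: q_def m_def)
  moreover have "l = q + (if m = 1 then 1 else 0)" using assms by (simp add: level_def q_def m_def)
  ultimately show ?thesis by (elim disjE) auto
qed

lemma centralD:
  assumes "central k S" "v \<in> S"
  shows "level k v = central_level k S"
  using assms unfolding central_def central_level_def by (metis imageI singletonD the_elem_eq)

lemma central_codes:
  assumes "central k S" "v \<in> S" "s = central_segment k S" "l = central_level k S"
  shows "code_of k v = 3 * l \<or> code_of k v = 3 * s + 1 \<or> code_of k v = 3 * s + 2"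
    and "3 * s \<le> code_of k v" "code_of k v \<le> 3 * s + 3"
proof -
  have "3 * l + 2 = Suc (Suc (3 * l))" by simp
  then have "(3 * l + 2) mod 3 = 2" by (simp only: code_div_mod)
  moreover have "n mod 3 = 1" if "n + 2 = 3 * l" for n using that by presburger
  ultimately have v: "code_of k v = 3 * l \<or> code_of k v = 3 * l + 2 \<and> code_of k v mod 3 = 2 \<or>
      (0 < l \<and> code_of k v + 2 = 3 * l \<and> code_of k v mod 3 = 1)"
    using codes_at_level[OF centralD[OF assms(1,2)]] assms(4) by auto
  have l0: "0 < l" if "\<exists>v \<in> S. code_of k v mod 3 = 1"
    using that centralD[OF assms(1)] assms(4) unfolding level_def by force
  have "code_of k v mod 3 \<noteq> 2" if "\<exists>v \<in> S. code_of k v mod 3 = 1"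
    using that assms(1,2) unfolding central_def by blast
  then show "code_of k v = 3 * l \<or> code_of k v = 3 * s + 1 \<or> code_of k v = 3 * s + 2"
    "3 * s \<le> code_of k v" "code_of k v \<le> 3 * s + 3"
    using v l0 assms(2,4) unfolding assms(3) central_segment_def by (auto split: if_splits)
qed

text \<open>Segments \<open>1\<close> to \<open>k\<close> touch neither end of the path, so the
  elements and tuples of all arguments are specified there.\<close>

lemma zz_segment_level:
  assumes "central k S" "S \<subseteq> V" "1 \<le> central_segment k S" "central_segment k S \<le> k"
  shows "0 < central_level k S" "central_level k S < k + 2"
  using assms by (auto simp: central_segment_def split: if_splits)

text \<open>An \<open>Elem\<close> carries no tuple and a \<open>Tup\<close> no element, so values
  computed from unspecified data at an end may differ without harm.\<close>

lemma code_vertex_eqI: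
  assumes "n \<noteq> 3 * (k + 2) \<Longrightarrow> a = a'" "n \<noteq> 0 \<Longrightarrow> r = r'"
  shows "code_vertex k a r n = code_vertex k a' r' n"
  using assms by (auto simp: code_vertex_def)

lemma segment_code_not_zz:
  assumes "\<not> (1 \<le> s \<and> s \<le> k)"
  shows "segment_code k g h s xs = 3 * central_level k (set xs)"
  using assms by (auto simp: segment_code_def zz_at_def)

lemma extreme_segment:
  assumes "central k S" "central_level k S = 0 \<or> central_level k S = k + 2"
  shows "\<not> (1 \<le> central_segment k S \<and> central_segment k S \<le> k)"
  using assms(2) by (auto simp: central_segment_def)

text \<open>Reading position \<open>i\<close> of every tuple is an assignment into \<open>A\<close>,
  so the identity holds coordinate by coordinate.\<close>

lemma lift_tup_eq:
  assumes "\<And>\<rho>. \<rho> ` (set xs \<union> set ys) \<subseteq> A \<Longrightarrow> g (map \<rho> xs) = g' (map \<rho> ys)"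
    and "\<And>x. x \<in> set xs \<union> set ys \<Longrightarrow> tup_of (\<sigma> x) \<in> R"
  shows "lift_tup k g (map \<sigma> xs) = lift_tup k g' (map \<sigma> ys)"
proof -
  have "tup_of (\<sigma> x) ! i \<in> A" if "i < k" "x \<in> set xs \<union> set ys" for i x
    using R_tuples[OF assms(2)[OF that(2)]] that(1) by (auto simp: subset_iff)
  then have "g (map (\<lambda>x. tup_of (\<sigma> x) ! i) xs) = g' (map (\<lambda>x. tup_of (\<sigma> x) ! i) ys)" if "i < k" for i
    using that by (intro assms(1)) auto
  then show ?thesis by (simp add: lift_tup_def comp_def)
qed

lemma lift_elem_eq:
  assumes "\<And>\<rho>. \<rho> ` (set xs \<union> set ys) \<subseteq> A \<Longrightarrow> g (map \<rho> xs) = g' (map \<rho> ys)"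
    and "\<And>x. x \<in> set xs \<union> set ys \<Longrightarrow> elem_of (\<sigma> x) \<in> A"
  shows "lift_elem g (map \<sigma> xs) = lift_elem g' (map \<sigma> ys)"
  unfolding lift_elem_def map_map by (rule assms(1)) (use assms(2) in auto)

lemma lift_op_balanced:
  assumes xy: "set xs = set ys" and \<sigma>: "\<sigma> ` set xs \<subseteq> V"
    and g: "\<And>\<rho>. \<rho> ` set xs \<subseteq> A \<Longrightarrow> g (map \<rho> xs) = g' (map \<rho> ys)"
    and h: "\<And>\<rho>. \<rho> ` set xs \<subseteq> {0..3} \<Longrightarrow> h (map \<rho> xs) = h' (map \<rho> ys)"
  shows "lift_op k eA eR g h (map \<sigma> xs) = lift_op k eA eR g' h' (map \<sigma> ys)"
proof -
  define S where "S = \<sigma> ` set xs"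
  have S: "set (map \<sigma> xs) = S" "set (map \<sigma> ys) = S" using xy by (simp_all add: S_def)
  show ?thesis
  proof (cases "central k S")
    case True
    define l where "l = central_level k S"
    define s where "s = central_segment k S"
    have lev: "level k (\<sigma> x) = l" if "x \<in> set xs" for x
      using centralD[OF True] that by (auto simp: S_def l_def)
    have el: "lift_elem g (map \<sigma> xs) = lift_elem g' (map \<sigma> ys)" if "l < k + 2"
      using that g \<sigma> lev vertex(2) xy by (intro lift_elem_eq) auto
    have tu: "lift_tup k g (map \<sigma> xs) = lift_tup k g' (map \<sigma> ys)" if "0 < l"
      using that g \<sigma> lev vertex(3) xy by (intro lift_tup_eq) auto
    have code: "segment_code k g h s (map \<sigma> xs) = segment_code k g' h' s (map \<sigma> ys)"
    proof (cases "1 \<le> s \<and> s \<le> k")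
      case zs: True
      then have "0 < l" "l < k + 2"
        using zz_segment_level[OF True] \<sigma> by (auto simp: S_def s_def l_def)
      moreover have "h (map (\<lambda>v. code_of k v - 3 * s) (map \<sigma> xs)) =
          h' (map (\<lambda>v. code_of k v - 3 * s) (map \<sigma> ys))"
        unfolding map_map
        by (rule h) (use central_codes(2,3)[OF True _ s_def l_def] in \<open>fastforce simp: S_def\<close>)
      ultimately show ?thesis
        using el tu unfolding segment_code_def S by simp
    next
      case False
      show ?thesis unfolding segment_code_not_zz[OF False] S ..
    qed
    have "central_op k g h (map \<sigma> xs) = central_op k g' h' (map \<sigma> ys)"
    proof (cases "l = 0 \<or> l = k + 2")
      case ext: True
      then have "\<not> (1 \<le> s \<and> s \<le> k)" using extreme_segment[OF True] by (simp add: s_def l_def)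
      then have "segment_code k g' h' s (map \<sigma> ys) = 3 * l"
        unfolding l_def S(2)[symmetric] by (rule segment_code_not_zz)
      then show ?thesis
        unfolding central_op_def S s_def[symmetric] code
        using ext el tu by (intro code_vertex_eqI) auto
    next
      case False
      moreover obtain x where "x \<in> set xs" using True by (auto simp: S_def central_def)
      ultimately have "0 < l" "l < k + 2" using lev[of x] vertex(1)[of "\<sigma> x"] \<sigma> by auto
      then show ?thesis unfolding central_op_def S s_def[symmetric] code using el tu by simp
    qed
    then show ?thesis using True by (simp only: lift_op_def S if_True)
  next
    case False
    have "h (map (\<lambda>v. if low k S v then 0 else 2) (map \<sigma> xs)) =
        h' (map (\<lambda>v. if low k S v then 0 else 2) (map \<sigma> ys))"
      unfolding map_map by (rule h) auto
    then have "split_op k h eA eR (map \<sigma> xs) = split_op k h' eA eR (map \<sigma> ys)"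
      by (simp only: split_op_def S)
    then show ?thesis using False by (simp only: lift_op_def S if_False)
  qed
qed

lemma not_central_low:
  assumes "\<not> central k S" "finite S" "S \<noteq> {}"
  shows "\<exists>v \<in> S. low k S v" "\<exists>v \<in> S. \<not> low k S v"
proof -
  let ?L = "level k ` S"
  have fin: "finite ?L" "?L \<noteq> {}" using assms by auto
  have "(\<exists>v \<in> S. low k S v) \<and> (\<exists>v \<in> S. \<not> low k S v)"
  proof (cases "card ?L = 1")
    case True
    then obtain l where "?L = {l}" by (auto simp: card_1_singleton_iff)
    then obtain u v where uv: "u \<in> S" "v \<in> S" "code_of k u mod 3 = 1" "code_of k v mod 3 = 2"
      using assms(1) unfolding central_def by blast
    then have "low k S u" "\<not> low k S v" using True by (simp_all add: low_def)
    then show ?thesis using uv by blast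
  next
    case False
    have "Min ?L \<in> ?L" using fin by simp
    moreover have "\<not> ?L \<subseteq> {Min ?L}"
    proof
      assume "?L \<subseteq> {Min ?L}"
      then have "card ?L \<le> card {Min ?L}" by (intro card_mono) auto
      moreover have "card ?L > 0" using fin by (simp only: card_gt_0_iff simp_thms)
      ultimately show False using False by simp
    qed
    ultimately show ?thesis using False by (auto simp: low_def image_iff)
  qed
  then show "\<exists>v \<in> S. low k S v" "\<exists>v \<in> S. \<not> low k S v" by auto
qed

lemma arg_min_on_singleton: "arg_min_on f {x} = (x :: 'b)" for f :: "'b \<Rightarrow> 'c :: order"
  using arg_min_if_finite(1)[of "{x}" f] by simp

text \<open>At most two vertices occur, so a group that contains \<open>\<sigma> y\<close> but not
  the other vertex is a singleton. The image path is that of \<open>\<sigma> y\<close>, and every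
  case of the construction returns the position of \<open>\<sigma> y\<close> on it.\<close>

lemma lift_op_absorb:
  assumes xy: "set xs \<subseteq> {x, y}" "y \<in> set xs" and \<sigma>: "\<sigma> ` set xs \<subseteq> V"
    and g: "\<And>\<rho>. \<rho> ` set xs \<subseteq> A \<Longrightarrow> g (map \<rho> xs) = \<rho> y"
    and h: "\<And>\<rho>. \<rho> ` set xs \<subseteq> {0..3} \<Longrightarrow> h (map \<rho> xs) = \<rho> y"
  shows "lift_op k eA eR g h (map \<sigma> xs) = \<sigma> y"
proof -
  define S where "S = \<sigma> ` set xs"
  have S: "set (map \<sigma> xs) = S" by (simp add: S_def)
  have y: "\<sigma> y \<in> S" "\<sigma> y \<in> V" using xy \<sigma> by (auto simp: S_def)
  have Sxy: "S \<subseteq> {\<sigma> x, \<sigma> y}" using xy by (auto simp: S_def)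
  show ?thesis
  proof (cases "central k S")
    case True
    define l where "l = central_level k S"
    define s where "s = central_segment k S"
    have lev: "level k (\<sigma> x) = l" if "x \<in> set xs" for x
      using centralD[OF True] that by (auto simp: S_def l_def)
    have el: "lift_elem g (map \<sigma> xs) = elem_of (\<sigma> y)" if "l < k + 2"
      unfolding lift_elem_def map_map
      by (rule trans[OF g]) (use that \<sigma> lev vertex(2) in auto)
    have tu: "lift_tup k g (map \<sigma> xs) = tup_of (\<sigma> y)" if "0 < l"
    proof -
      \<comment> \<open>The right-hand side of the absorption law is the projection
        \<open>hd\<close> applied to the list of the one variable \<open>y\<close>.\<close>
      have "lift_tup k g (map \<sigma> xs) = lift_tup k hd (map \<sigma> [y])"
        by (rule lift_tup_eq) (use that g \<sigma> lev vertex(3) xy(2) in \<open>auto simp: insert_absorb\<close>)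
      also have "\<dots> = tup_of (\<sigma> y)"
        using R_tuples[OF vertex(3)[OF y(2)]] that lev[OF xy(2)] map_nth[of "tup_of (\<sigma> y)"]
        by (simp add: lift_tup_def)
      finally show ?thesis .
    qed
    note codes = central_codes[OF True _ s_def l_def]
    have code: "segment_code k g h s (map \<sigma> xs) = code_of k (\<sigma> y)"
    proof (cases "zz_at k (lift_elem g (map \<sigma> xs)) (lift_tup k g (map \<sigma> xs)) s")
      case zs: True
      then have "0 < l" "l < k + 2"
        using zz_segment_level[OF True] \<sigma> by (auto simp: S_def s_def l_def zz_at_def)
      then have zy: "zz_vertex k s (\<sigma> y)" using zs el tu by (simp add: zz_vertex_def)
      show ?thesis
      proof (cases "\<forall>v \<in> S. zz_vertex k s v")
        case all: True
        have "h (map (\<lambda>v. code_of k v - 3 * s) (map \<sigma> xs)) = code_of k (\<sigma> y) - 3 * s"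
          unfolding map_map
          by (rule trans[OF h]) (use codes(2,3) in \<open>fastforce simp: S_def\<close>)+
        then show ?thesis using zs all codes(2)[OF y(1)] unfolding segment_code_def S by simp
      next
        case False
        \<comment> \<open>\<open>\<sigma> y\<close> lies on a path with a zigzag here, so the
          argument that has none must be the other vertex.\<close>
        then have "{v \<in> S. zz_vertex k s v} = {\<sigma> y}" using zy Sxy y(1) by blast
        then show ?thesis unfolding segment_code_def S if_P[OF zs] if_not_P[OF False] by simp
      qed
    next
      case False
      \<comment> \<open>Offsets \<open>1\<close> and \<open>2\<close> exist in zigzags only, and
        there \<open>\<sigma> y\<close> would force the image segment to be a zigzag.\<close>
      have "code_of k (\<sigma> y) = 3 * l"
      proof (rule ccontr)
        assume ne: "code_of k (\<sigma> y) \<noteq> 3 * l"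
        then have c: "code_of k (\<sigma> y) = Suc (3 * s) \<or> code_of k (\<sigma> y) = Suc (Suc (3 * s))"
          using codes(1)[OF y(1)] by auto
        then have "code_of k (\<sigma> y) mod 3 \<noteq> 0" "code_of k (\<sigma> y) div 3 = s" by auto
        then have "zz_vertex k s (\<sigma> y)" using vertex(5)[OF y(2)] by simp
        moreover have "0 < l" "l < k + 2" 
          using zz_segment_level[OF True] \<sigma> \<open>zz_vertex k s (\<sigma> y)\<close> by (auto simp: S_def s_def l_def zz_vertex_def zz_at_def)
        ultimately show False using False el tu by (simp add: zz_vertex_def)
      qed
      then show ?thesis using False unfolding segment_code_def S l_def by simp
    qed
    have "central_op k g h (map \<sigma> xs) =
        code_vertex k (elem_of (\<sigma> y)) (tup_of (\<sigma> y)) (code_of k (\<sigma> y))"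
      unfolding central_op_def S s_def[symmetric] code
      using el tu lev[OF xy(2)] vertex(1,6,7)[OF y(2)] by (intro code_vertex_eqI) auto
    then show ?thesis using True vertex(4)[OF y(2)] by (simp only: lift_op_def S if_True)
  next
    case False
    have "finite S" "S \<noteq> {}" using y by (auto simp: S_def)
    note low = not_central_low[OF False this]
    have "card (level k ` S) \<le> card {level k (\<sigma> x), level k (\<sigma> y)}"
      using Sxy by (intro card_mono) auto
    also have "\<dots> \<le> 2" by (simp add: card_insert_if)
    finally have card: "card (level k ` S) \<le> 2" .
    have h: "h (map (\<lambda>v. if low k S v then 0 else 2) (map \<sigma> xs)) = (if low k S (\<sigma> y) then 0 else 2)"
      unfolding map_map by (rule trans[OF h]) auto
    have "split_op k h eA eR (map \<sigma> xs) = \<sigma> y"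
    proof (cases "low k S (\<sigma> y)")
      case True
      then have "{v \<in> S. low k S v} = {\<sigma> y}" using low Sxy y(1) by blast
      then show ?thesis using True h unfolding split_op_def S by (simp add: arg_min_on_singleton)
    next
      case False
      then have "{v \<in> S. \<not> low k S v} = {\<sigma> y}" using low Sxy y(1) by blast
      then show ?thesis using False h card unfolding split_op_def S by (simp add: arg_min_on_singleton)
    qed
    then show ?thesis using False by (simp only: lift_op_def S if_False)
  qed
qed

end


section \<open>Lifted operations preserve edges and vertices\<close>

lemma (in code_digraph) edge_vertices:
  assumes "(u, v) \<in> E"
  shows "u \<in> V" "v \<in> V"
proof -
  obtain a r m n where *: "a \<in> A" "r \<in> R" "(m, n) \<in> zz_edges (zz_at k a r) (k + 2)"
    "u = code_vertex k a r m" "v = code_vertex k a r n"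
    using assms unfolding code_edges_def by blast
  then show "u \<in> V" "v \<in> V"
    using zz_edges_codes[OF *(3)] code_vertex_in[OF *(1,2)] by auto
qed

lemma (in code_digraph) edge_at_level:
  assumes "(u, v) \<in> E" "level k u = s"
  shows "code_of k u = 3 * s \<or> code_of k u = 3 * s + 2"
    and "code_of k v = 3 * s + 1 \<or> code_of k v = 3 * s + 3"
    and "1 \<le> s \<Longrightarrow> s \<le> k \<Longrightarrow> zz_vertex k s v = zz_vertex k s u"
    and "zz_vertex k s u \<Longrightarrow> (code_of k u - 3 * s, code_of k v - 3 * s) \<in> {(0, 1), (2, 1), (2, 3)}"
proof -
  obtain a r t i j where *: "t < k + 2" "u = code_vertex k a r (3 * t + i)"
    "v = code_vertex k a r (3 * t + j)" "(i, j) \<in> segment_edges (zz_at k a r t)"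
    using assms(1) by (rule code_edges_cases)
  have ij: "i = 0 \<or> i = 2" "j = 1 \<or> j = 3" using *(4) by (auto split: if_splits)
  have t: "t = s" using assms(2) ij(1) level_code_vertex[of k a r t] *(2) by auto
  show "code_of k u = 3 * s \<or> code_of k u = 3 * s + 2" "code_of k v = 3 * s + 1 \<or> code_of k v = 3 * s + 3"
    using ij * t by auto
  have zz: "zz_vertex k s u = zz_at k a r s" "zz_vertex k s v = zz_at k a r s" if "1 \<le> s" "s \<le> k"
    using that ij * t by (auto simp: zz_vertex_def elem_of_code_vertex tup_of_code_vertex)
  then show "1 \<le> s \<Longrightarrow> s \<le> k \<Longrightarrow> zz_vertex k s v = zz_vertex k s u" by simp
  show "(code_of k u - 3 * s, code_of k v - 3 * s) \<in> {(0, 1), (2, 1), (2, 3)}" if "zz_vertex k s u"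
  proof -
    have "1 \<le> s" "s \<le> k" using that by (auto simp: zz_vertex_def zz_at_def)
    then show ?thesis using zz that * t by simp
  qed
qed

text \<open>The minima may be attained at different indices \<open>i\<close> and \<open>j\<close>.
  If \<open>key (u i) < key (u j)\<close>, monotonicity and minimality give \<open>v i\<close> and
  \<open>v j\<close> equal keys, so \<open>v i = v j\<close>; otherwise \<open>u i = u j\<close>.
  Either way one of the given edges joins the minima.\<close>

lemma arg_min_on_edge:
  fixes key :: "'v \<Rightarrow> 'b :: linorder"
  assumes "finite I" "I \<noteq> {}" and e: "\<And>i. i \<in> I \<Longrightarrow> (u i, v i) \<in> E"
    and mono: "\<And>i j. i \<in> I \<Longrightarrow> j \<in> I \<Longrightarrow> key (u i) < key (u j) \<Longrightarrow> key (v i) \<le> key (v j)"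
    and inj: "inj_on key (u ` I)" "inj_on key (v ` I)"
  shows "(arg_min_on key (u ` I), arg_min_on key (v ` I)) \<in> E"
proof -
  have fin: "finite (u ` I)" "u ` I \<noteq> {}" "finite (v ` I)" "v ` I \<noteq> {}" using assms(1,2) by auto
  obtain i where i: "i \<in> I" "arg_min_on key (u ` I) = u i"
    using arg_min_if_finite(1)[OF fin(1,2), of key] by auto
  obtain j where j: "j \<in> I" "arg_min_on key (v ` I) = v j"
    using arg_min_if_finite(1)[OF fin(3,4), of key] by auto
  have "key (u i) \<le> key (u j)"
    using arg_min_least[OF fin(1,2), of "u j" key] i j by simp
  moreover have vji: "key (v j) \<le> key (v i)"
    using arg_min_least[OF fin(3,4), of "v i" key] i j by simp
  ultimately have "u i = u j \<or> v i = v j"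
    using mono[OF i(1) j(1)] inj_onD[OF inj(1), of "u i" "u j"] inj_onD[OF inj(2), of "v i" "v j"] i j
    by (cases "key (u i) < key (u j)") auto
  then show ?thesis using e[OF i(1)] e[OF j(1)] i j by auto
qed

locale liftable_op = code_digraph +
  fixes n :: nat and g :: "'a list \<Rightarrow> 'a" and h :: "nat list \<Rightarrow> nat"
    and eA :: "'a \<Rightarrow> nat" and eR :: "'a list \<Rightarrow> nat"
  assumes n_pos: "0 < n"
    and g_elem: "\<And>xs. length xs = n \<Longrightarrow> set xs \<subseteq> A \<Longrightarrow> g xs \<in> A"
    and g_tup: "\<And>rs. length rs = n \<Longrightarrow> set rs \<subseteq> R \<Longrightarrow> map (\<lambda>i. g (map (\<lambda>r. r ! i) rs)) [0..<k] \<in> R"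
    and h_range: "\<And>xs. length xs = n \<Longrightarrow> set xs \<subseteq> {0..3} \<Longrightarrow> h xs \<le> 3"
    and h_edge: "\<And>us vs. length us = n \<Longrightarrow>
      list_all2 (\<lambda>u v. (u, v) \<in> {(0, 1), (2, 1), (2, 3)}) us vs \<Longrightarrow> (h us, h vs) \<in> {(0, 1), (2, 1), (2, 3)}"
    and h_idem: "\<And>z. z \<le> 3 \<Longrightarrow> h (replicate n z) = z"
    and inj_eA: "inj_on eA A" and inj_eR: "inj_on eR R"
begin

text \<open>If all arguments have a single edge at segment \<open>s\<close>, each element equals the
  entry of its tuple for that segment. Applying \<open>g\<close> to both lists gives the same
  equality for the image. Hence the minimum in \<open>segment_code\<close> is taken over a nonempty
  set.\<close>

lemma zz_exists:
  assumes "zz_at k (lift_elem g xs) (lift_tup k g xs) s"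
  shows "\<exists>v \<in> set xs. zz_vertex k s v"
proof (rule ccontr)
  assume none: "\<not> ?thesis"
  have s: "1 \<le> s" "s \<le> k" using assms by (auto simp: zz_at_def)
  then have "map elem_of xs = map (\<lambda>v. tup_of v ! (s - 1)) xs"
    using none by (auto simp: zz_vertex_def zz_at_def)
  then have "g (map elem_of xs) = g (map (\<lambda>v. tup_of v ! (s - 1)) xs)" by (rule arg_cong)
  then have "lift_elem g xs = lift_tup k g xs ! (s - 1)"
    using s nth_upt[of 0 "s - 1" k] by (simp add: lift_elem_def lift_tup_def)
  then show False using assms by (simp add: zz_at_def)
qed

text \<open>A vertex between two segments may be counted to either one: \<open>h\<close> is
  idempotent at offsets \<open>0\<close> and \<open>3\<close>, and the minimum of equal codes is
  that code. This settles targets that all lie at \<open>3 * s + 3\<close>, which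
  \<open>central_segment\<close> counts to segment \<open>Suc s\<close> and not to the segment of
  the edges.\<close>

lemma segment_code_cut:
  assumes "length xs = n" "\<And>v. v \<in> set xs \<Longrightarrow> code_of k v = 3 * s + i" "i \<le> 3"
    and "3 * central_level k (set xs) = 3 * s + i"
  shows "segment_code k g h s xs = 3 * s + i"
proof (cases "zz_at k (lift_elem g xs) (lift_tup k g xs) s")
  case True
  have "map (\<lambda>v. code_of k v - 3 * s) xs = replicate n i"
    using assms(1,2) by (auto intro!: replicate_eqI)
  moreover have "code_of k ` {v \<in> set xs. zz_vertex k s v} = {3 * s + i}"
    using zz_exists[OF True] assms(2) by (auto simp: image_iff)
  ultimately show ?thesis
    unfolding segment_code_def if_P[OF True] using h_idem[OF assms(3)] by simp
qed (simp add: segment_code_def assms)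

lemma lift_op_edge_central:
  assumes len: "length us = n" and e: "list_all2 (\<lambda>u v. (u, v) \<in> E) us vs" and c: "central k (set us)"
  shows "(lift_op k eA eR g h us, lift_op k eA eR g h vs) \<in> E"
proof -
  define s where "s = central_level k (set us)"
  have len': "length vs = n" using e len by (simp add: list_all2_lengthD)
  have nth: "(us ! i, vs ! i) \<in> E" if "i < n" for i using e len that by (simp add: list_all2_conv_all_nth)
  have ue: "\<exists>v \<in> set vs. (u, v) \<in> E" if "u \<in> set us" for u
    using that nth len len' by (metis in_set_conv_nth)
  have ve: "\<exists>u \<in> set us. (u, v) \<in> E" if "v \<in> set vs" for v
    using that nth len len' by (metis in_set_conv_nth)
  have lev: "level k u = s" if "u \<in> set us" for u using centralD[OF c that] s_def by simp
  have lev': "level k v = Suc s" if "v \<in> set vs" for v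
    using ve[OF that] lev code_edges_level(1) by metis
  have ne: "us \<noteq> []" "vs \<noteq> []" using n_pos len len' by auto
  have sk: "s < k + 2" using ue lev code_edges_level(2) ne(1) by (metis hd_in_set)
  have lv: "level k ` set vs = {Suc s}" using lev' ne(2) by (auto simp: image_iff) (metis list.set_intros(1) neq_Nil_conv)
  have u_mod: "code_of k u mod 3 \<noteq> 1" if "u \<in> set us" for u using ue[OF that] code_edges_level(5) by metis
  have v_mod: "code_of k v mod 3 \<noteq> 2" if "v \<in> set vs" for v using ve[OF that] code_edges_level(6) by metis
  have c': "central k (set vs)" using lv v_mod unfolding central_def by blast
  have cl': "central_level k (set vs) = Suc s" using lv by (simp add: central_level_def)
  have seg: "central_segment k (set us) = s" using u_mod by (auto simp: central_segment_def s_def)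
  have v_code: "code_of k v = 3 * s + 1 \<or> code_of k v = 3 * s + 3" if "v \<in> set vs" for v
    using ve[OF that] edge_at_level(2) lev by metis
  have seg': "segment_code k g h (central_segment k (set vs)) vs = segment_code k g h s vs"
  proof (cases "\<exists>v \<in> set vs. code_of k v mod 3 = 1")
    case True
    then show ?thesis by (simp add: central_segment_def cl')
  next
    case False
    then have "code_of k v = 3 * s + 3" if "v \<in> set vs" for v using v_code[OF that] that by auto
    then have "segment_code k g h s vs = 3 * s + 3" "segment_code k g h (Suc s) vs = 3 * Suc s + 0"
      by (intro segment_code_cut len'; simp add: cl')+
    then show ?thesis using False by (simp add: central_segment_def cl')
  qed
  \<comment> \<open>Sources always have an element and targets always a tuple, while the tuple of a
    source is missing at level \<open>0\<close> and the element of a target at the top. So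
    \<open>a\<close> is read from the sources and \<open>r\<close> from the targets.\<close>
  define a where "a = lift_elem g us"
  define r where "r = lift_tup k g vs"
  have "a \<in> A"
    unfolding a_def lift_elem_def using ue edge_vertices(1) vertex(2) lev sk len
    by (intro g_elem) (auto, metis)
  have "r \<in> R"
  proof -
    have "set (map tup_of vs) \<subseteq> R" using ve edge_vertices(2) vertex(3) lev' by (auto, metis zero_less_Suc)
    then show ?thesis
      unfolding r_def lift_tup_def using g_tup[of "map tup_of vs"] len' by (simp add: comp_def)
  qed
  have el: "lift_elem g vs = a" if "s \<noteq> k + 1"
  proof -
    have "elem_of (us ! i) = elem_of (vs ! i)" if "i < n" for i
      using code_edges_level(3)[OF nth[OF that]] lev' that len' sk \<open>s \<noteq> k + 1\<close> by simp
    then have "map elem_of us = map elem_of vs" using len len' by (auto intro: nth_equalityI)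
    then show ?thesis by (simp add: a_def lift_elem_def)
  qed
  have tu: "lift_tup k g us = r" if "s \<noteq> 0"
  proof -
    have "tup_of (us ! i) = tup_of (vs ! i)" if "i < n" for i
      using code_edges_level(4)[OF nth[OF that]] lev that len \<open>s \<noteq> 0\<close> by simp
    then have "map (\<lambda>v. tup_of v ! m) us = map (\<lambda>v. tup_of v ! m) vs" for m
      using len len' by (auto intro: nth_equalityI)
    then show ?thesis by (simp add: r_def lift_tup_def)
  qed
  have "\<exists>i j. segment_code k g h s us = 3 * s + i \<and> segment_code k g h s vs = 3 * s + j \<and>
      (i, j) \<in> segment_edges (zz_at k a r s)"
  proof (cases "zz_at k a r s")
    case True
    then have s: "1 \<le> s" "s \<le> k" by (auto simp: zz_at_def)
    have el: "lift_elem g us = a" "lift_elem g vs = a" and tu: "lift_tup k g us = r" "lift_tup k g vs = r"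
      using el tu s by (simp_all add: a_def r_def)
    have zz: "zz_vertex k s (vs ! i) = zz_vertex k s (us ! i)" if "i < n" for i
      using edge_at_level(3)[OF nth[OF that] _ s] lev len that by simp
    have edge: "(code_of k (us ! i) - 3 * s, code_of k (vs ! i) - 3 * s) \<in> {(0, 1), (2, 1), (2, 3)}"
      if "i < n" "zz_vertex k s (us ! i)" for i
      using edge_at_level(4)[OF nth[OF that(1)]] that lev len by simp
    have le: "3 * s \<le> code_of k (us ! i)" "3 * s \<le> code_of k (vs ! i)" if "i < n" for i
      using edge_at_level(1,2)[OF nth[OF that]] lev len that by force+
    show ?thesis
    proof (cases "\<forall>v \<in> set us. zz_vertex k s v")
      case all: True
      then have all': "\<forall>v \<in> set vs. zz_vertex k s v"
        using zz len len' by (auto simp: all_set_conv_all_nth)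
      have "(h (map (\<lambda>v. code_of k v - 3 * s) us), h (map (\<lambda>v. code_of k v - 3 * s) vs)) \<in> {(0, 1), (2, 1), (2, 3)}"
        by (rule h_edge) (use edge all len len' in \<open>auto simp: list_all2_conv_all_nth\<close>)
      then show ?thesis using True unfolding segment_code_def el tu if_P[OF all] if_P[OF all'] by simp
    next
      case False
      have False': "\<not> (\<forall>v \<in> set vs. zz_vertex k s v)"
        using False zz len len' by (auto simp: all_set_conv_all_nth)
      let ?I = "{i. i < n \<and> zz_vertex k s (us ! i)}"
      let ?M = "Min ((\<lambda>i. code_of k (us ! i)) ` ?I)" and ?N = "Min ((\<lambda>i. code_of k (vs ! i)) ` ?I)"
      have M: "code_of k ` {v \<in> set us. zz_vertex k s v} = (\<lambda>i. code_of k (us ! i)) ` ?I"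
        using len by (auto simp: in_set_conv_nth)
      have N: "code_of k ` {v \<in> set vs. zz_vertex k s v} = (\<lambda>i. code_of k (vs ! i)) ` ?I"
        using len' zz by (auto simp: in_set_conv_nth)
      have I: "finite ?I" "?I \<noteq> {}"
        using zz_exists[of us s] True len unfolding el tu by (auto simp: in_set_conv_nth)
      have "?M \<in> (\<lambda>i. code_of k (us ! i)) ` ?I" using I by (intro Min_in) auto
      then obtain i where i: "i \<in> ?I" "?M = code_of k (us ! i)" by (rule imageE)
      have "?N \<in> (\<lambda>i. code_of k (vs ! i)) ` ?I" using I by (intro Min_in) auto
      then obtain j where j: "j \<in> ?I" "?N = code_of k (vs ! j)" by (rule imageE)
      \<comment> \<open>If the least source has offset \<open>0\<close>, its own target has offset
        \<open>1\<close> and bounds the least target. This excludes the offsets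
        \<open>(0, 3)\<close>, the only combination of a source and a target that is not an
        edge.\<close>
      have "?N \<le> code_of k (vs ! i)" using I i(1) by (intro Min_le) auto
      then have "(?M - 3 * s, ?N - 3 * s) \<in> {(0, 1), (2, 1), (2, 3)}" "3 * s \<le> ?M" "3 * s \<le> ?N"
        using edge[of i] edge[of j] le[of i] le[of j] i j by auto
      then show ?thesis
        using True unfolding segment_code_def el tu if_not_P[OF False] if_not_P[OF False'] M N
        by (intro exI[of _ "?M - 3 * s"] exI[of _ "?N - 3 * s"]) simp
    qed
  next
    case False
    then have "\<not> zz_at k (lift_elem g us) (lift_tup k g us) s" "\<not> zz_at k (lift_elem g vs) (lift_tup k g vs) s"
      using el tu by (auto simp: zz_at_def a_def r_def)
    then show ?thesis using False by (simp add: segment_code_def cl' s_def[symmetric])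
  qed
  then obtain i j where ij: "segment_code k g h s us = 3 * s + i" "segment_code k g h s vs = 3 * s + j"
    "(i, j) \<in> segment_edges (zz_at k a r s)" by blast
  have "lift_op k eA eR g h us = code_vertex k a r (3 * s + i)"
    unfolding lift_op_def if_P[OF c] central_op_def seg ij a_def[symmetric]
  proof (rule code_vertex_eqI)
    show "lift_tup k g us = r" if "3 * s + i \<noteq> 0"
      using that tu ij(3) by (cases "s = 0") (auto simp: zz_at_def)
  qed simp
  moreover have "lift_op k eA eR g h vs = code_vertex k a r (3 * s + j)"
    unfolding lift_op_def if_P[OF c'] central_op_def seg' ij r_def[symmetric]
  proof (rule code_vertex_eqI)
    show "lift_elem g vs = a" if "3 * s + j \<noteq> 3 * (k + 2)"
      using that el ij(3) by (cases "s = k + 1") (auto simp: zz_at_def)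
  qed simp
  ultimately show ?thesis using code_edgesI[OF \<open>a \<in> A\<close> \<open>r \<in> R\<close> sk ij(3)] by simp
qed

lemma low_key_inj:
  assumes "u \<in> V" "v \<in> V" "level k u = level k v" "level k v < k + 2"
    "low_key k eA eR u = low_key k eA eR v"
  shows "u = v"
proof -
  have eq: "eA (elem_of u) = eA (elem_of v)" "eR (tup_of u) = eR (tup_of v)" "code_of k u = code_of k v"
    using assms(5) by (auto simp: low_key_def)
  have "elem_of u = elem_of v"
    using eq(1) inj_onD[OF inj_eA] vertex(2) assms by simp
  moreover have "tup_of u = tup_of v" if "code_of k v \<noteq> 0"
    using that eq(2) inj_onD[OF inj_eR] vertex(3) vertex(6)[OF assms(2)] assms by simp
  ultimately show ?thesis
    using vertex(4)[OF assms(1)] vertex(4)[OF assms(2)] eq(3) by (metis code_vertex_eqI)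
qed

lemma high_key_inj:
  assumes "u \<in> V" "v \<in> V" "level k u = level k v" "0 < level k v"
    "high_key k eA eR u = high_key k eA eR v"
  shows "u = v"
proof -
  have eq: "eA (elem_of u) = eA (elem_of v)" "eR (tup_of u) = eR (tup_of v)" "code_of k u = code_of k v"
    using assms(5) by (auto simp: high_key_def)
  have "tup_of u = tup_of v"
    using eq(2) inj_onD[OF inj_eR] vertex(3) assms by simp
  moreover have "elem_of u = elem_of v" if "code_of k v \<noteq> 3 * (k + 2)"
  proof -
    have "level k v < k + 2" using vertex(1,7)[OF assms(2)] that by simp
    then show ?thesis using eq(1) inj_onD[OF inj_eA] vertex(2) assms by simp
  qed
  ultimately show ?thesis
    using vertex(4)[OF assms(1)] vertex(4)[OF assms(2)] eq(3) by (metis code_vertex_eqI)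
qed

text \<open>Distinct sources on one level of one path sit at offsets \<open>0\<close> and
  \<open>2\<close> of a zigzag, and offset \<open>0\<close> leads only to offset \<open>1\<close>,
  the smaller of the possible targets.\<close>

lemma code_mono:
  assumes e: "(u, v) \<in> E" "(u', v') \<in> E" and lev: "level k u = level k u'"
    and eq: "elem_of u = elem_of u'" "tup_of u = tup_of u'"
    and less: "code_of k u < code_of k u'"
  shows "code_of k v \<le> code_of k v'"
proof -
  define s where "s = level k u"
  have "code_of k u = 3 * s" "code_of k u' = 3 * s + 2"
    using less edge_at_level(1)[OF e(1)] edge_at_level(1)[OF e(2)] lev by (auto simp: s_def)
  moreover have "zz_vertex k s u'"
  proof -
    have "code_of k u' = Suc (Suc (3 * s))" using \<open>code_of k u' = 3 * s + 2\<close> by simp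
    then have "code_of k u' mod 3 = 2" "code_of k u' div 3 = s" by (simp_all only: code_div_mod)
    then show ?thesis using vertex(5)[OF edge_vertices(1)[OF e(2)]] by simp
  qed
  then have "zz_vertex k s u" using eq by (simp add: zz_vertex_def)
  ultimately have "code_of k v \<le> 3 * s + 1"
    using edge_at_level(4)[OF e(1), of s] by (auto simp: s_def)
  then show ?thesis using edge_at_level(2)[OF e(2), of s] lev by (auto simp: s_def)
qed

text \<open>Below the top the element persists along an edge. At level \<open>0\<close> it
  determines the source, hence decides every strict comparison before the tuple picked up by the
  target is consulted; higher up the tuple persists too and \<open>code_mono\<close> settles
  ties.\<close>

lemma low_key_mono:
  assumes e: "(u, v) \<in> E" "(u', v') \<in> E" and lev: "level k u = level k u'" "level k v < k + 2"
    and less: "low_key k eA eR u < low_key k eA eR u'"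
  shows "low_key k eA eR v \<le> low_key k eA eR v'"
proof -
  note V = edge_vertices[OF e(1)] edge_vertices[OF e(2)]
  have lev': "level k v' = level k v" using code_edges_level(1)[OF e(1)] code_edges_level(1)[OF e(2)] lev by simp
  have el: "elem_of u = elem_of v" "elem_of u' = elem_of v'"
    using code_edges_level(3)[OF e(1)] code_edges_level(3)[OF e(2)] lev lev' by auto
  have inA: "elem_of u \<in> A" "elem_of u' \<in> A"
    using el vertex(2) V lev lev' by auto
  show ?thesis
  proof (cases "level k u = 0")
    case True
    then have "code_of k u = 0" "code_of k u' = 0" using vertex(6)[OF V(1)] vertex(6)[OF V(3)] lev by auto
    moreover have "elem_of u \<noteq> elem_of u'"
    proof
      assume "elem_of u = elem_of u'"
      then have "u = u'" using calculation vertex(4)[OF V(1)] vertex(4)[OF V(3)]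
        by (metis code_vertex_eqI)
      then show False using less by simp
    qed
    then have "eA (elem_of u) \<noteq> eA (elem_of u')" using inj_onD[OF inj_eA] inA by blast
    then show ?thesis using less el by (auto simp: low_key_def)
  next
    case False
    then have tu: "tup_of u = tup_of v" "tup_of u' = tup_of v'"
      using code_edges_level(4)[OF e(1)] code_edges_level(4)[OF e(2)] lev by auto
    have inR: "tup_of u \<in> R" "tup_of u' \<in> R" using vertex(3) V lev False by auto
    show ?thesis
    proof (cases "eA (elem_of u) = eA (elem_of u') \<and> eR (tup_of u) = eR (tup_of u')")
      case True
      then have eq: "elem_of u = elem_of u'" "tup_of u = tup_of u'"
        using inj_onD[OF inj_eA] inA inj_onD[OF inj_eR] inR by blast+
      then have "code_of k u < code_of k u'" using less by (simp add: low_key_def)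
      then show ?thesis using code_mono[OF e lev(1) eq] el tu eq by (simp add: low_key_def)
    next
      case False
      then show ?thesis using less el tu by (auto simp: low_key_def)
    qed
  qed
qed

text \<open>Above level \<open>0\<close> the tuple persists along an edge. If the targets are at the
  top, equal tuples make them coincide; below it the element persists too and
  \<open>code_mono\<close> settles ties.\<close>

lemma high_key_mono:
  assumes e: "(u, v) \<in> E" "(u', v') \<in> E" and lev: "level k u = level k u'" "0 < level k u"
    and less: "high_key k eA eR u < high_key k eA eR u'"
  shows "high_key k eA eR v \<le> high_key k eA eR v'"
proof -
  note V = edge_vertices[OF e(1)] edge_vertices[OF e(2)]
  have lev': "level k v' = level k v" using code_edges_level(1)[OF e(1)] code_edges_level(1)[OF e(2)] lev by simp
  have tu: "tup_of u = tup_of v" "tup_of u' = tup_of v'"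
    using code_edges_level(4)[OF e(1)] code_edges_level(4)[OF e(2)] lev by auto
  have inR: "tup_of u \<in> R" "tup_of u' \<in> R" using vertex(3) V lev by auto
  have inA: "elem_of u \<in> A" "elem_of u' \<in> A"
    using vertex(2) V code_edges_level(2)[OF e(1)] lev by auto
  show ?thesis
  proof (cases "tup_of u = tup_of u'")
    case eqR: True
    show ?thesis
    proof (cases "level k v < k + 2")
      case True
      then have el: "elem_of u = elem_of v" "elem_of u' = elem_of v'"
        using code_edges_level(3)[OF e(1)] code_edges_level(3)[OF e(2)] lev' by auto
      show ?thesis
      proof (cases "eA (elem_of u) = eA (elem_of u')")
        case True
        then have eq: "elem_of u = elem_of u'"
          using inj_onD[OF inj_eA] inA by blast
        then have "code_of k u < code_of k u'" using less eqR by (simp add: high_key_def)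
        then show ?thesis using code_mono[OF e lev(1) eq eqR] el tu eq eqR by (simp add: high_key_def)
      next
        case False
        then show ?thesis using less el tu eqR by (auto simp: high_key_def)
      qed
    next
      case False
      then have "code_of k v = 3 * (k + 2)" "code_of k v' = 3 * (k + 2)"
        using vertex(1,7)[OF V(2)] vertex(1,7)[OF V(4)] lev' by auto
      then have "v = v'" using vertex(4)[OF V(2)] vertex(4)[OF V(4)] tu eqR by (metis code_vertex_eqI)
      then show ?thesis by simp
    qed
  next
    case False
    then have "eR (tup_of u) \<noteq> eR (tup_of u')" using inj_onD[OF inj_eR] inR by blast
    then show ?thesis using less tu by (auto simp: high_key_def)
  qed
qed

lemma lift_op_edge_not_central:
  assumes len: "length us = n" and e: "list_all2 (\<lambda>u v. (u, v) \<in> E) us vs" and c: "\<not> central k (set us)"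
  shows "(lift_op k eA eR g h us, lift_op k eA eR g h vs) \<in> E"
proof -
  have len': "length vs = n" using e len by (simp add: list_all2_lengthD)
  have nth: "(us ! i, vs ! i) \<in> E" if "i < n" for i using e len that by (simp add: list_all2_conv_all_nth)
  have set: "set us = (!) us ` {..<n}" "set vs = (!) vs ` {..<n}"
    using len len' by (auto simp: set_conv_nth)
  let ?L = "level k ` set us"
  have levels: "level k ` set vs = Suc ` ?L"
    using code_edges_level(1)[OF nth] by (auto simp: set image_image)
  have fin: "finite ?L" "?L \<noteq> {}" using n_pos len by auto
  have card: "card (level k ` set vs) = card ?L" unfolding levels by (simp add: card_image)
  have min: "Min (level k ` set vs) = Suc (Min ?L)"
    unfolding levels using mono_Min_commute[OF _ fin, of Suc] by (simp add: mono_def)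
  have u_mod: "code_of k u mod 3 \<noteq> 1" if "u \<in> set us" for u
    using that code_edges_level(5)[OF nth] by (auto simp: set)
  \<comment> \<open>Sources never have offset \<open>1\<close>, so on a single level they would be
    central.\<close>
  have "card ?L \<noteq> 1"
  proof
    assume "card ?L = 1"
    then obtain l where "?L = {l}" by (auto simp: card_1_singleton_iff)
    then show False using c u_mod unfolding central_def by blast
  qed
  then have c': "\<not> central k (set vs)" using card by (auto simp: central_def)
  have low: "low k (set us) (us ! i) \<longleftrightarrow> level k (us ! i) = Min ?L"
    "low k (set vs) (vs ! i) \<longleftrightarrow> low k (set us) (us ! i)" if "i < n" for i
    using \<open>card ?L \<noteq> 1\<close> card min code_edges_level(1)[OF nth[OF that]] by (simp_all add: low_def)
  let ?I = "{i. i < n \<and> low k (set us) (us ! i)}" and ?J = "{i. i < n \<and> \<not> low k (set us) (us ! i)}"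
  have I: "{v \<in> set us. low k (set us) v} = (!) us ` ?I" "{v \<in> set vs. low k (set vs) v} = (!) vs ` ?I"
    and J: "{v \<in> set us. \<not> low k (set us) v} = (!) us ` ?J" "{v \<in> set vs. \<not> low k (set vs) v} = (!) vs ` ?J"
    using low(2) by (auto simp: set)
  have "us \<noteq> []" using n_pos len by auto
  note lows = not_central_low[OF c finite_set, simplified, OF this]
  have ne: "?I \<noteq> {}" "?J \<noteq> {}" using lows by (auto simp: set)
  \<comment> \<open>An edge raises the level by one, so sources and targets split into the same
    groups and \<open>h\<close> selects the same one.\<close>
  have pattern: "map (\<lambda>v. if low k (set us) v then 0 else 2) us =
      map (\<lambda>v. if low k (set vs) v then 0 else (2 :: nat)) vs"
    using low(2) len len' by (auto intro!: nth_equalityI)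
  have V: "us ! i \<in> V" "vs ! i \<in> V" if "i < n" for i using edge_vertices[OF nth[OF that]] by auto
  have lev': "level k (vs ! i) = Suc (level k (us ! i))" if "i < n" for i
    using code_edges_level(1)[OF nth[OF that]] .
  have minle: "Min ?L \<le> level k (us ! i)" if "i < n" for i
    using that len fin by (intro Min_le) auto
  have lowlev: "level k (us ! i) = Min ?L" if "i \<in> ?I" for i using that low(1) by auto
  \<comment> \<open>Some source lies above the lowest level and still below the top, so the targets
    of the low sources stay below the top, where their elements are specified.\<close>
  have minlt: "Min ?L < k + 1"
  proof -
    obtain j where "j \<in> ?J" using ne(2) by blast
    then have j: "j < n" "level k (us ! j) \<noteq> Min ?L" using low(1) by auto
    then show ?thesis using minle[OF j(1)] code_edges_level(2)[OF nth[OF j(1)]] by simp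
  qed
  have low_edge: "(arg_min_on (low_key k eA eR) ((!) us ` ?I), arg_min_on (low_key k eA eR) ((!) vs ` ?I)) \<in> E"
  proof (rule arg_min_on_edge)
    show "inj_on (low_key k eA eR) ((!) us ` ?I)" "inj_on (low_key k eA eR) ((!) vs ` ?I)"
      using V lowlev lev' minlt by (auto intro!: inj_onI low_key_inj)
    show "low_key k eA eR (vs ! i) \<le> low_key k eA eR (vs ! j)"
      if "i \<in> ?I" "j \<in> ?I" "low_key k eA eR (us ! i) < low_key k eA eR (us ! j)" for i j
      using that nth lowlev lev' minlt by (intro low_key_mono[of "us ! i" _ "us ! j"]) auto
  qed (use ne nth in auto)
  have high_edge: "(arg_min_on (high_key k eA eR) ((!) us ` ?J), arg_min_on (high_key k eA eR) ((!) vs ` ?J)) \<in> E"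
    if card2: "card ?L \<le> 2"
  proof (rule arg_min_on_edge)
    have "card ?L = 2"
      using card2 \<open>card ?L \<noteq> 1\<close> fin by (metis One_nat_def card_0_eq le_neq_implies_less less_2_cases)
    then obtain l m where lm: "?L = {l, m}" "l \<noteq> m" by (auto simp: card_2_iff)
    \<comment> \<open>With exactly two levels, the arguments that are not low share one level above
      \<open>0\<close>, where \<open>high_key\<close> is injective and monotone along edges.\<close>
    have highlev: "level k (us ! i) = level k (us ! j)" "0 < level k (us ! i)"
      if "i \<in> ?J" "j \<in> ?J" for i j
    proof -
      have *: "level k (us ! i) \<noteq> Min ?L" "level k (us ! j) \<noteq> Min ?L" using that low(1) by auto
      have "Min ?L = l \<or> Min ?L = m" "level k (us ! i) = l \<or> level k (us ! i) = m"
        "level k (us ! j) = l \<or> level k (us ! j) = m"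
        using that len lm(1) Min_in[OF fin] by (auto simp: set)
      then show "level k (us ! i) = level k (us ! j)" using * by auto
      show "0 < level k (us ! i)" using * minle[of i] that by auto
    qed
    show "inj_on (high_key k eA eR) ((!) us ` ?J)" "inj_on (high_key k eA eR) ((!) vs ` ?J)"
    proof -
      have inj: "inj_on (high_key k eA eR) (w ` ?J)"
        if w: "\<And>i. i \<in> ?J \<Longrightarrow> w i \<in> V" "\<And>i. i \<in> ?J \<Longrightarrow> 0 < level k (w i)"
          "\<And>i j. i \<in> ?J \<Longrightarrow> j \<in> ?J \<Longrightarrow> level k (w i) = level k (w j)" for w
      proof (rule inj_onI)
        fix u v assume "u \<in> w ` ?J" "v \<in> w ` ?J" and eq: "high_key k eA eR u = high_key k eA eR v"
        then obtain i j where ij: "i \<in> ?J" "j \<in> ?J" "u = w i" "v = w j" by blast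
        show "u = v"
          using high_key_inj[OF w(1)[OF ij(1)] w(1)[OF ij(2)] w(3)[OF ij(1,2)] w(2)[OF ij(2)]] eq ij(3,4)
          by simp
      qed
      show "inj_on (high_key k eA eR) ((!) us ` ?J)"
        by (rule inj) (use V(1) highlev(2) in blast, use highlev(2) in blast, fact highlev(1))
      show "inj_on (high_key k eA eR) ((!) vs ` ?J)"
      proof (rule inj)
        fix i j assume ij: "i \<in> ?J" "j \<in> ?J"
        then have "i < n" "j < n" by auto
        then show "level k (vs ! i) = level k (vs ! j)" using lev' highlev(1)[OF ij] by simp
      qed (use V(2) lev' in auto)
    qed
    show "high_key k eA eR (vs ! i) \<le> high_key k eA eR (vs ! j)"
      if "i \<in> ?J" "j \<in> ?J" "high_key k eA eR (us ! i) < high_key k eA eR (us ! j)" for i j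
      using that nth highlev[OF that(1,2)] by (intro high_key_mono[of "us ! i" _ "us ! j"]) auto
  qed (use ne nth in auto)
  show ?thesis
    unfolding lift_op_def if_not_P[OF c] if_not_P[OF c'] split_op_def card pattern I J
    using low_edge high_edge by simp
qed

lemma lift_op_vertex:
  assumes len: "length xs = n" and xs: "set xs \<subseteq> V"
  shows "lift_op k eA eR g h xs \<in> V"
proof (cases "central k (set xs)")
  case True
  define l where "l = central_level k (set xs)"
  define s where "s = central_segment k (set xs)"
  define c where "c = segment_code k g h s xs"
  have ne: "xs \<noteq> []" using n_pos len by auto
  have lev: "level k v = l" if "v \<in> set xs" for v using centralD[OF True that] by (simp add: l_def)
  have lk: "l \<le> k + 2" using lev[of "hd xs"] vertex(1)[OF subsetD[OF xs, of "hd xs"]] ne by simp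
  note codes = central_codes[OF True _ s_def l_def]
  obtain a0 r0 where "a0 \<in> A" "r0 \<in> R" using A_ne R_ne by blast
  have ae: "lift_elem g xs \<in> A" if "l < k + 2"
    unfolding lift_elem_def using vertex(2) xs lev len that by (intro g_elem) auto
  have re: "lift_tup k g xs \<in> R" if "0 < l"
  proof -
    have "set (map tup_of xs) \<subseteq> R" using vertex(3) xs lev that by auto
    then show ?thesis
      unfolding lift_tup_def using g_tup[of "map tup_of xs"] len by (simp add: comp_def)
  qed
  show ?thesis
  proof (cases "l = 0 \<or> l = k + 2")
    case ext: True
    then have "\<not> (1 \<le> s \<and> s \<le> k)" using extreme_segment[OF True] by (simp add: s_def l_def)
    then have "c = 3 * l" unfolding c_def l_def by (rule segment_code_not_zz)
    then have "lift_op k eA eR g h xs = (if l = 0 then Elem (lift_elem g xs) else Tup (lift_tup k g xs))"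
      unfolding lift_op_def if_P[OF True] central_op_def s_def[symmetric] c_def[symmetric]
      using ext by (auto simp: code_vertex_def)
    then show ?thesis using ae re ext by (auto simp: code_vertices_def)
  next
    case False
    then have l: "0 < l" "l < k + 2" using lk by auto
    have "c \<in> zz_codes (zz_at k (lift_elem g xs) (lift_tup k g xs)) (k + 2)"
    proof (cases "zz_at k (lift_elem g xs) (lift_tup k g xs) s")
      case zz: True
      have "c \<le> 3 * s + 3 \<and> 3 * s \<le> c"
      proof (cases "\<forall>v \<in> set xs. zz_vertex k s v")
        case all: True
        have "h (map (\<lambda>v. code_of k v - 3 * s) xs) \<le> 3"
          by (rule h_range) (use codes(3) len in \<open>fastforce+\<close>)
        then show ?thesis unfolding c_def segment_code_def if_P[OF zz] if_P[OF all] by simp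
      next
        case notall: False
        have "code_of k ` {v \<in> set xs. zz_vertex k s v} \<noteq> {}" using zz_exists[OF zz] by auto
        then have "c \<in> code_of k ` {v \<in> set xs. zz_vertex k s v}"
          unfolding c_def segment_code_def if_P[OF zz] if_not_P[OF notall] by (intro Min_in) auto
        then show ?thesis using codes(2,3) by auto
      qed
      then have "c = 3 * s \<or> c = Suc (3 * s) \<or> c = Suc (Suc (3 * s)) \<or> c = 3 * s + 3" by auto
      moreover have "s \<le> k" using zz by (simp add: zz_at_def)
      ultimately show ?thesis using zz by (elim disjE) (simp_all add: zz_codes_def)
    next
      case notzz: False
      then have "c = 3 * l" unfolding c_def l_def segment_code_def by (rule if_not_P)
      then show ?thesis using l by (simp add: zz_codes_def)
    qed
    then show ?thesis
      unfolding lift_op_def if_P[OF True] central_op_def s_def[symmetric] c_def[symmetric]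
      using ae re l by (intro code_vertex_in) auto
  qed
next
  case False
  have "xs \<noteq> []" using n_pos len by auto
  note low = not_central_low[OF False finite_set, simplified, OF this]
  have "arg_min_on f {v \<in> set xs. P v} \<in> set xs" if "\<exists>v \<in> set xs. P v"
    for P and f :: "'a dvertex \<Rightarrow> nat \<times> nat \<times> nat"
    using arg_min_if_finite(1)[of "{v \<in> set xs. P v}" f] that by auto
  then have "split_op k h eA eR xs \<in> set xs" unfolding split_op_def using low by auto
  then show ?thesis using False xs by (auto simp: lift_op_def)
qed

lemma lift_op_polymorphism: "polymorphism (digraph V E) n (lift_op k eA eR g h)"
  unfolding polymorphism_digraph_iff
  using lift_op_vertex lift_op_edge_central lift_op_edge_not_central by blast

end


section \<open>Lifting an interpretation of all symbols\<close>

lemma univ_path_digraph_zigzag: "univ (path_digraph zigzag) = {0..3}"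
  by (simp add: path_digraph_def digraph_def zigzag_def)

lemma (in code_digraph) liftable_opI:
  assumes fin: "finite_rel_structure \<A>" "A = univ \<A>" "R = total_rel \<A>" "k = total_arity \<A>"
    and n: "0 < n" and g: "polymorphism \<A> n g" and h: "polymorphism (path_digraph zigzag) n h"
    and idem: "\<And>z. z \<le> 3 \<Longrightarrow> h (replicate n z) = z"
    and inj: "inj_on eA A" "inj_on eR R"
  shows "liftable_op A R k n g h eA eR"
proof unfold_locales
  fix xs assume "length xs = n" "set xs \<subseteq> A"
  then show "g xs \<in> A" using g fin(2) by (simp add: polymorphism_def)
next
  fix rs assume rs: "length rs = n" "set rs \<subseteq> R"
  have "\<forall>(k, S) \<in> set (rels \<A>). (\<forall>t \<in> S. length t = k) \<and>
      (\<forall>ts. length ts = n \<and> set ts \<subseteq> S \<longrightarrow> map (\<lambda>i. g (map (\<lambda>t. t ! i) ts)) [0..<k] \<in> S)"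
    using finite_rel_structure_rels(1)[OF fin(1)] g unfolding polymorphism_def by blast
  then show "map (\<lambda>i. g (map (\<lambda>r. r ! i) rs)) [0..<k] \<in> R"
    using product_rel_coordinatewise[of "rels \<A>" n g rs] rs fin
    by (simp add: total_rel_def product_rel_def total_arity_def)
next
  fix xs :: "nat list" assume "length xs = n" "set xs \<subseteq> {0..3}"
  then show "h xs \<le> 3"
    using h by (simp add: polymorphism_def univ_path_digraph_zigzag subset_iff)
next
  fix us vs :: "nat list" assume "length us = n" "list_all2 (\<lambda>u v. (u, v) \<in> {(0, 1), (2, 1), (2, 3)}) us vs"
  then show "(h us, h vs) \<in> {(0, 1), (2, 1), (2, 3)}"
    using h unfolding path_digraph_def polymorphism_digraph_iff path_edges_zigzag by blast
qed (use n idem inj in auto)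

lemma satisfies_idempotent:
  assumes idem: "idempotent_identities ar \<Sigma>" and f: "f \<in> symbols_of \<Sigma>"
    and I: "\<And>u v \<sigma>. (u, v) \<in> \<Sigma> \<Longrightarrow> range \<sigma> \<subseteq> B \<Longrightarrow> eval_trm I \<sigma> u = eval_trm I \<sigma> v"
    and x: "x \<in> B"
  shows "I f (replicate (ar f) x) = x"
proof -
  obtain y where y: "(App f (replicate (ar f) (Var y)), Var y) \<in> \<Sigma>"
    using idem f by (auto simp: idempotent_identities_def)
  have "eval_trm I (\<lambda>_. x) (App f (replicate (ar f) (Var y))) = eval_trm I (\<lambda>_. x) (Var y)"
    by (rule I[OF y]) (use x in auto)
  then show ?thesis by simp
qed

lemma symbols_subset:
  "(u, v) \<in> \<Sigma> \<Longrightarrow> symbols u \<union> symbols v \<subseteq> symbols_of \<Sigma>"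
  unfolding symbols_of_def by blast

text \<open>Satisfaction speaks of assignments of all variables; those outside the identity are sent
  to an arbitrary element of \<open>B\<close>.\<close>

lemma eval_eq_on_vars:
  assumes eq: "\<And>\<sigma>. range \<sigma> \<subseteq> B \<Longrightarrow> eval_trm I \<sigma> u = eval_trm I \<sigma> v"
    and lin: "symbol_occs u \<le> 1" "symbol_occs v \<le> 1"
    and \<rho>: "\<rho> ` (vars u \<union> vars v) \<subseteq> B" "B \<noteq> {}"
  shows "term_op I u (map \<rho> (term_args u)) = term_op I v (map \<rho> (term_args v))"
proof -
  obtain b where "b \<in> B" using \<rho>(2) by blast
  define \<sigma> where "\<sigma> x = (if x \<in> vars u \<union> vars v then \<rho> x else b)" for x
  have "range \<sigma> \<subseteq> B" using \<rho>(1) \<open>b \<in> B\<close> by (auto simp: \<sigma>_def)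
  then have "eval_trm I \<sigma> u = eval_trm I \<sigma> v" by (rule eq)
  moreover have maps: "map \<sigma> (term_args u) = map \<rho> (term_args u)" "map \<sigma> (term_args v) = map \<rho> (term_args v)"
    using set_term_args[OF lin(1)] set_term_args[OF lin(2)] by (auto simp: \<sigma>_def)
  ultimately show ?thesis
    unfolding eval_trm_linear[OF lin(1)] eval_trm_linear[OF lin(2)] maps by simp
qed

text \<open>A linear term in the single variable \<open>y\<close> is \<open>y\<close> or
  \<open>f(y, ..., y)\<close>, which idempotence collapses.\<close>

lemma term_op_const:
  assumes idem: "idempotent_identities ar \<Sigma>"
    and w: "symbol_occs w \<le> 1" "wf_trm ar w" "symbols w \<subseteq> symbols_of \<Sigma>"
    and I: "\<And>u v \<sigma>. (u, v) \<in> \<Sigma> \<Longrightarrow> range \<sigma> \<subseteq> B \<Longrightarrow> eval_trm I \<sigma> u = eval_trm I \<sigma> v"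
    and y: "vars w = {y}" "\<rho> y \<in> B"
  shows "term_op I w (map \<rho> (term_args w)) = \<rho> y"
proof (cases w)
  case (App f ts)
  have "term_args w = replicate (ar f) y"
    using set_term_args[OF w(1)] length_term_args[OF w(2)] y(1) App
    by (intro replicate_eqI) (auto simp: term_arity_def)
  moreover have "f \<in> symbols_of \<Sigma>" using w(3) App by simp
  ultimately show ?thesis using satisfies_idempotent[OF idem _ I y(2)] App by simp
qed (use y in simp)

lemma two_element_cases:
  assumes "finite (X \<union> Y)" "card (X \<union> Y) \<le> 2" "X \<noteq> {}" "Y \<noteq> {}" "X \<noteq> Y"
  obtains x y where "X = {x}" "Y = {y}" "x \<noteq> y" | x y where "X = {x, y}" "Y = {y}"
    | x y where "X = {y}" "Y = {x, y}"
proof -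
  have "card (X \<union> Y) \<noteq> 0" using assms(1,3) by simp
  moreover have "card (X \<union> Y) \<noteq> 1"
  proof
    assume "card (X \<union> Y) = 1"
    then obtain z where "X \<union> Y = {z}" by (auto simp: card_1_singleton_iff)
    then have "X = {z}" "Y = {z}" using assms(3,4) unfolding Un_singleton_iff by auto
    then show False using assms(5) by simp
  qed
  ultimately have "card (X \<union> Y) = 2" using assms(2) by simp
  then obtain a b where ab: "X \<union> Y = {a, b}" by (auto simp: card_2_iff)
  have "Z = {a} \<or> Z = {b} \<or> Z = {a, b}" if "Z \<subseteq> {a, b}" "Z \<noteq> {}" for Z
    using that by (cases "a \<in> Z"; cases "b \<in> Z") auto
  then have "X = {a} \<or> X = {b} \<or> X = {a, b}" "Y = {a} \<or> Y = {b} \<or> Y = {a, b}"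
    using assms(3,4) ab Un_upper1[of X Y] Un_upper2[of Y X] by simp_all
  then show thesis
    using that(1)[of a b] that(1)[of b a] that(2)[of a b] that(2)[of b a] that(3)[of a b] that(3)[of b a]
      assms(5) by (elim disjE) (simp_all add: insert_commute)
qed

lemma satisfies_code_digraph:
  fixes \<A> :: "'a rel_structure" and \<Sigma> :: "('f, 'v) identity set"
  assumes fin: "finite_rel_structure \<A>"
    and wf: "wf_identities ar \<Sigma>"
    and lin: "linear_identities \<Sigma>"
    and idem: "idempotent_identities ar \<Sigma>"
    and zz: "satisfies ar (path_digraph zigzag) \<Sigma>"
    and bal: "\<forall>p \<in> \<Sigma>. balanced_identity p \<or> card (vars_identity p) \<le> 2"
    and sat: "satisfies ar \<A> \<Sigma>"
  shows "satisfies ar (digraph (code_vertices (univ \<A>) (total_rel \<A>) (total_arity \<A>))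
      (code_edges (univ \<A>) (total_rel \<A>) (total_arity \<A>))) \<Sigma>"
proof -
  define A where "A = univ \<A>"
  define R where "R = total_rel \<A>"
  define k where "k = total_arity \<A>"
  note rels = finite_rel_structure_rels[OF fin]
  have finA: "finite A" "finite R" using fin rels(5) by (auto simp: finite_rel_structure_def A_def R_def)
  interpret code_digraph A R k
    by unfold_locales (use rels in \<open>auto simp: A_def R_def k_def\<close>)
  \<comment> \<open>Arbitrary numberings of elements and tuples supply the orders behind the choice
    of a least argument.\<close>
  obtain eA :: "'a \<Rightarrow> nat" where eA: "inj_on eA A" using finite_imp_inj_to_nat_seg[OF finA(1)] by blast
  obtain eR :: "'a list \<Rightarrow> nat" where eR: "inj_on eR R" using finite_imp_inj_to_nat_seg[OF finA(2)] by blast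
  obtain G where G: "\<And>f. f \<in> symbols_of \<Sigma> \<Longrightarrow> polymorphism \<A> (ar f) (G f)"
    "\<And>u v \<sigma>. (u, v) \<in> \<Sigma> \<Longrightarrow> range \<sigma> \<subseteq> A \<Longrightarrow> eval_trm G \<sigma> u = eval_trm G \<sigma> v"
    using sat unfolding satisfies_def A_def by blast
  obtain H where H: "\<And>f. f \<in> symbols_of \<Sigma> \<Longrightarrow> polymorphism (path_digraph zigzag) (ar f) (H f)"
    "\<And>u v \<sigma>. (u, v) \<in> \<Sigma> \<Longrightarrow> range \<sigma> \<subseteq> {0..3} \<Longrightarrow> eval_trm H \<sigma> u = eval_trm H \<sigma> v"
  proof -
    obtain H where "\<forall>f \<in> symbols_of \<Sigma>. polymorphism (path_digraph zigzag) (ar f) (H f)"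
      "\<forall>(u, v) \<in> \<Sigma>. \<forall>\<sigma>. range \<sigma> \<subseteq> {0..3} \<longrightarrow> eval_trm H \<sigma> u = eval_trm H \<sigma> v"
      using zz unfolding satisfies_def univ_path_digraph_zigzag by blast
    then show thesis by (intro that[of H]) blast+
  qed
  let ?lift = "lift_op k eA eR"
  define I where "I f = ?lift (G f) (H f)" for f
  have "polymorphism (digraph V E) (ar f) (I f)" if f: "f \<in> symbols_of \<Sigma>" for f
  proof -
    have "H f (replicate (ar f) z) = z" if "z \<le> 3" for z
      by (rule satisfies_idempotent[OF idem f H(2)]) (use that in auto)
    moreover have "0 < ar f" using symbols_of_arity[OF wf f] by simp
    ultimately interpret liftable_op A R k "ar f" "G f" "H f" eA eR
      using fin G(1)[OF f] H(1)[OF f] eA eR by (intro liftable_opI[of \<A>]) (auto simp: A_def R_def k_def)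
    show ?thesis unfolding I_def by (rule lift_op_polymorphism)
  qed
  moreover have "eval_trm I \<sigma> u = eval_trm I \<sigma> v"
    if uv: "(u, v) \<in> \<Sigma>" and \<sigma>: "range \<sigma> \<subseteq> V" for u v \<sigma>
  proof -
    have occs: "symbol_occs u \<le> 1" "symbol_occs v \<le> 1"
      using lin uv by (auto simp: linear_identities_def linear_identity_def)
    have wft: "wf_trm ar u" "wf_trm ar v" using wf uv by (auto simp: wf_identities_def)
    \<comment> \<open>For an application this is the lifted symbol, for a variable the lift of the
      projections \<open>hd\<close>; one formula thus covers both sides of an identity.\<close>
    define t where "t = (\<lambda>w :: ('f, 'v) trm. ?lift (term_op G w) (term_op H w) (map \<sigma> (term_args w)))"
    have g: "term_op G u (map \<rho> (term_args u)) = term_op G v (map \<rho> (term_args v))"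
      if "\<rho> ` (vars u \<union> vars v) \<subseteq> A" for \<rho>
      by (rule eval_eq_on_vars[OF G(2)[OF uv] occs that A_ne])
    have h: "term_op H u (map \<rho> (term_args u)) = term_op H v (map \<rho> (term_args v))"
      if "\<rho> ` (vars u \<union> vars v) \<subseteq> {0..3}" for \<rho>
      by (rule eval_eq_on_vars[OF H(2)[OF uv] occs that]) simp_all
    note args = set_term_args[OF occs(1)] set_term_args[OF occs(2)]
    have I: "eval_trm I \<sigma> w = t w" if "symbol_occs w \<le> 1" for w
    proof (cases w)
      case (Var x)
      \<comment> \<open>The lift of a projection is a projection: the trivial instance of
        absorption.\<close>
      have "t w = \<sigma> x"
        unfolding t_def Var by (rule lift_op_absorb[of _ x]) (use \<sigma> in auto)
      then show ?thesis using Var by simp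
    next
      case (App f ts)
      then show ?thesis using eval_trm_linear[OF that, of I \<sigma>] by (simp add: t_def I_def)
    qed
    have sides: "symbol_occs w \<le> 1" "wf_trm ar w" "symbols w \<subseteq> symbols_of \<Sigma>"
      if "w \<in> {u, v}" for w
      using symbols_subset[OF uv] occs wft that by auto
    have constG: "term_op G w (map \<rho> (term_args w)) = \<rho> y"
      if w: "w \<in> {u, v}" and y: "vars w = {y}" "\<rho> y \<in> A" for w y \<rho>
      by (rule term_op_const[where \<rho> = \<rho>, OF idem sides[OF w] G(2) y])
    have constH: "term_op H w (map \<rho> (term_args w)) = \<rho> y"
      if w: "w \<in> {u, v}" and y: "vars w = {y}" "\<rho> y \<in> {0..3}" for w y \<rho>
      by (rule term_op_const[where \<rho> = \<rho>, OF idem sides[OF w] H(2) y])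
    have absorb: "t w = \<sigma> y"
      if w: "w \<in> {u, v}" "vars w \<subseteq> {x, y}" "y \<in> vars w"
        and op: "\<And>\<rho>. \<rho> ` vars w \<subseteq> A \<Longrightarrow> term_op G w (map \<rho> (term_args w)) = \<rho> y"
          "\<And>\<rho>. \<rho> ` vars w \<subseteq> {0..3} \<Longrightarrow> term_op H w (map \<rho> (term_args w)) = \<rho> y"
      for w x y
    proof -
      have "set (term_args w) = vars w" using args w(1) by auto
      then show ?thesis
        unfolding t_def using w(2,3) op \<sigma> by (intro lift_op_absorb[of _ x]) auto
    qed
    \<comment> \<open>Idempotence turns the side \<open>w'\<close> into \<open>y\<close>, which
      leaves an absorption law for \<open>w\<close> in both \<A> and the zigzag.\<close>
    have mixed: "t w = t w'"
      if w: "w \<in> {u, v}" "w' \<in> {u, v}" "vars w = {x, y}" "vars w' = {y}"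
        and eq: "\<And>\<rho>. \<rho> ` {x, y} \<subseteq> A \<Longrightarrow> term_op G w (map \<rho> (term_args w)) = term_op G w' (map \<rho> (term_args w'))"
          "\<And>\<rho>. \<rho> ` {x, y} \<subseteq> {0..3} \<Longrightarrow> term_op H w (map \<rho> (term_args w)) = term_op H w' (map \<rho> (term_args w'))"
      for w w' x y
    proof -
      have "t w' = \<sigma> y"
        using w(4) constG[OF w(2,4)] constH[OF w(2,4)] by (intro absorb[OF w(2), of y y]) auto
      moreover have "t w = \<sigma> y"
      proof (rule absorb[OF w(1), of x y])
        show "term_op G w (map \<rho> (term_args w)) = \<rho> y" if "\<rho> ` vars w \<subseteq> A" for \<rho>
          using eq(1)[of \<rho>] constG[OF w(2,4), of \<rho>] that w(3) by simp
        show "term_op H w (map \<rho> (term_args w)) = \<rho> y" if "\<rho> ` vars w \<subseteq> {0..3}" for \<rho>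
          using eq(2)[of \<rho>] constH[OF w(2,4), of \<rho>] that w(3) by simp
      qed (use w(3) in auto)
      ultimately show ?thesis by simp
    qed
    have "t u = t v"
    proof (cases "vars u = vars v")
      case True
      then show ?thesis
        unfolding t_def using args g h \<sigma> by (intro lift_op_balanced) auto
    next
      case False
      have ne: "vars u \<noteq> {}" "vars v \<noteq> {}"
        using args term_args_nonempty[OF wft(1)] term_args_nonempty[OF wft(2)] by auto
      have "finite (vars u \<union> vars v)" using args by (metis finite_set finite_UnI)
      moreover have "card (vars u \<union> vars v) \<le> 2"
        using bal uv False by (auto simp: balanced_identity_def vars_identity_def)
      ultimately consider x y where "vars u = {x}" "vars v = {y}" "x \<noteq> y"
        | x y where "vars u = {x, y}" "vars v = {y}" | x y where "vars u = {y}" "vars v = {x, y}"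
        by (rule two_element_cases[OF _ _ ne False])
      then show ?thesis
      proof cases
        case (1 x y)
        \<comment> \<open>Idempotence would turn this identity into \<open>x \<approx> y\<close>,
          which the two distinct vertices \<open>0\<close> and \<open>1\<close> of the zigzag
          refute.\<close>
        define \<rho> where "\<rho> z = (if z = x then 0 else 1 :: nat)" for z
        have "term_op H u (map \<rho> (term_args u)) = 0" "term_op H v (map \<rho> (term_args v)) = 1"
          using constH[of u x \<rho>] constH[of v y \<rho>] 1 by (auto simp: \<rho>_def)
        moreover have "\<rho> ` (vars u \<union> vars v) \<subseteq> {0..3}" by (auto simp: \<rho>_def)
        ultimately show ?thesis using h[of \<rho>] by simp
      next
        case (2 x y)
        then show ?thesis by (intro mixed[of u v x y]) (use g h in auto)
      next
        case (3 x y)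
        then have "t v = t u" by (intro mixed[of v u x y]) (use g h in \<open>auto intro: sym\<close>)
        then show ?thesis by simp
      qed
    qed
    then show ?thesis using I occs by simp
  qed
  ultimately show ?thesis
    unfolding satisfies_def A_def[symmetric] R_def[symmetric] k_def[symmetric]
    by (intro exI[of _ I]) (auto simp: digraph_def)
qed

theorem theorem5:
  fixes \<A> :: "'a rel_structure"
    and ar :: "'f \<Rightarrow> nat"
    and \<Sigma> :: "('f, 'v) identity set"
  assumes "finite_rel_structure \<A>"
    and "wf_identities ar \<Sigma>"
    and "linear_identities \<Sigma>"
    and "idempotent_identities ar \<Sigma>"
    and "satisfies ar (path_digraph zigzag) \<Sigma>"
    and "\<forall>p \<in> \<Sigma>. balanced_identity p \<or> card (vars_identity p) \<le> 2"
  shows "satisfies ar (D_digraph \<A>) \<Sigma> \<longleftrightarrow> satisfies ar \<A> \<Sigma>"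
  unfolding satisfies_D_digraph_coded[OF assms(3,2)]
  using satisfies_of_code_digraph[OF assms(1,3)] satisfies_code_digraph[OF assms] by blast

end
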